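(* Let $\varepsilon>0$, $U_0>0$, $V_0>0$. Then there exists a unique solution $f$, with associated free-boundary position $a>0$, of the problem $$\begin{aligned} &-\tfrac12\eta f'(\eta)=[\phi'(f(\eta))f'(\eta)]' &&\text{if }0<\eta<a,\\ &-\tfrac12\eta f'(\eta)=[\varepsilon\phi'(-f(\eta))f'(\eta)]' &&\text{if }\eta>a,\\ &f(0)=U_0,\qquad \lim_{\eta\to\infty}f(\eta)=-V_0,\\ &\lim_{\eta\nearrow a}f(\eta)=0=-\lim_{\eta\searrow a}f(\eta),\\ &\lim_{\eta\nearrow a}\phi'(f(\eta))f'(\eta)=\varepsilon\lim_{\eta\searrow a}\phi'(-f(\eta))f'(\eta), \end{aligned}$$ where a prime on $f$ or on a bracket denotes differentiation with respect to $\eta$.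
   Context: $\phi\in C^2(\mathbb{R})$ is such that $\phi$ and $\phi'$ are strictly increasing on $[0,\infty)$, $\phi(s)>0$ for $s>0$, $\phi(0)=\phi'(0)=0$, and $\int_0^1\frac{\phi'(s)}{s}\,ds<\infty$, $\int_1^\infty\frac{\phi'(s)}{s}\,ds=\infty$. The constant $a>0$ is part of the unknown. A solution is a continuous function $f:[0,\infty)\to\mathbb{R}$ together with $a>0$ such that $f>0$ on $[0,a)$, $f<0$ on $(a,\infty)$, $f$ is $C^2$ on $(0,a)$ and on $(a,\infty)$, and all the relations hold. *)

theory Defs
  imports "HOL-Analysis.Analysis"
begin

text \<open>Intended for open \<open>S\<close>, where all derivatives are two-sided.\<close>

definition C2_on :: "(real \<Rightarrow> real) \<Rightarrow> real set \<Rightarrow> bool" where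
  "C2_on f S \<longleftrightarrow>
     (\<forall>x\<in>S. f differentiable (at x)) \<and>
     (\<forall>x\<in>S. deriv f differentiable (at x)) \<and>
     continuous_on S (deriv (deriv f))"

text \<open>
  A solution is a function on \<open>[0,\<infinity>)\<close>; only the restriction of \<open>f\<close> to \<open>{0..}\<close> is
  constrained, its values at negative arguments are irrelevant. The one-sided limits of the
  flux at \<open>a\<close> are required to exist as real numbers.
\<close>

definition fb_solution ::
  "(real \<Rightarrow> real) \<Rightarrow> real \<Rightarrow> real \<Rightarrow> real \<Rightarrow> (real \<Rightarrow> real) \<Rightarrow> real \<Rightarrow> bool" where
  "fb_solution \<phi> \<epsilon> U0 V0 f a \<longleftrightarrow>
     a > 0 \<and>
     continuous_on {0..} f \<and>
     (\<forall>\<eta>\<in>{0..<a}. f \<eta> > 0) \<and>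
     (\<forall>\<eta>\<in>{a<..}. f \<eta> < 0) \<and>
     C2_on f {0<..<a} \<and>
     C2_on f {a<..} \<and>
     (\<forall>\<eta>\<in>{0<..<a}.
        ((\<lambda>x. deriv \<phi> (f x) * deriv f x) has_real_derivative - (1/2) * \<eta> * deriv f \<eta>) (at \<eta>)) \<and>
     (\<forall>\<eta>\<in>{a<..}.
        ((\<lambda>x. \<epsilon> * deriv \<phi> (- f x) * deriv f x) has_real_derivative - (1/2) * \<eta> * deriv f \<eta>) (at \<eta>)) \<and>
     f 0 = U0 \<and>
     (f \<longlongrightarrow> - V0) at_top \<and>
     (f \<longlongrightarrow> 0) (at_left a) \<and>
     ((\<lambda>\<eta>. - f \<eta>) \<longlongrightarrow> 0) (at_right a) \<and>
     (\<exists>l r. ((\<lambda>\<eta>. deriv \<phi> (f \<eta>) * deriv f \<eta>) \<longlongrightarrow> l) (at_left a) \<and>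
            ((\<lambda>\<eta>. deriv \<phi> (- f \<eta>) * deriv f \<eta>) \<longlongrightarrow> r) (at_right a) \<and>
            l = \<epsilon> * r)"

end

theory Submission
  imports Defs
begin

text \<open>
  Use \<open>s = f\<close> as independent variable. Let \<open>q\<close> be minus the flux \<open>\<psi>(f) f'\<close>, where \<open>\<psi>(s)\<close> is
  \<open>\<phi>'(s)\<close> for \<open>s \<ge> 0\<close> and \<open>\<epsilon> \<phi>'(-s)\<close> for \<open>s < 0\<close>. Both equations become \<open>dq/ds = \<eta>/2\<close>, and
  \<open>d\<eta>/ds = - \<psi>/q\<close>, so the free boundary problem turns into the single singular problem
  \<open>q'' = - \<psi> / (2 q)\<close> on \<open>(-V0, U0)\<close> with \<open>q(-V0) = 0\<close> and \<open>q'(U0) = 0\<close>; the free boundary is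
  \<open>a = 2 q'(0)\<close> and \<open>f\<close> is the inverse function of \<open>2 q'\<close>. As the right-hand side is increasing
  in \<open>q\<close>, the difference \<open>w\<close> of two solutions satisfies \<open>(w w')' \<ge> 0\<close>, which gives uniqueness.
  Existence follows by replacing the condition at \<open>-V0\<close> by \<open>q(-V0) = \<delta>\<close> and letting \<open>\<delta> \<rightarrow> 0\<close>.
\<close>

subsection \<open>Energy estimate\<close>

text \<open>The change of variable removes two obstacles at once. The unknown front becomes the
  fixed point s = 0, and the degeneracy \<psi>(0) = 0, which spoils control of f' at the front,
  becomes a harmless zero of the right-hand side; matching of the fluxes turns into mere continuity
  of q at 0. What stays singular is the end -V0, where q = 0 stands in a denominator: this condition
  encodes that the flux dies out at infinity. With the value \<delta> > 0 there, the problem is a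
  fixed point equation for an order-reversing map, whose iterates converge in ratio. The energy
  inequality also bounds the distance of two regularised solutions by |\<delta>1 - \<delta>2|, so
  the passage to the limit needs no compactness argument, and an upper bound on q returns a lower
  bound independent of \<delta> that keeps the limit positive inside. That 2 q' sweeps out all of
  (0, \<infinity>), so that f is defined on the whole half-line, is not imposed: it follows from a
  logarithmic divergence at -V0.\<close>

lemma energy_nonpos:
  fixes w w' c :: "real \<Rightarrow> real"
  assumes w: "\<And>s. s \<in> {A<..<B} \<Longrightarrow> (w has_real_derivative w' s) (at s)"
    and w': "\<And>s. s \<in> {A<..<B} \<Longrightarrow> (w' has_real_derivative c s * w s) (at s)"
    and c: "\<And>s. s \<in> {A<..<B} \<Longrightarrow> c s \<ge> 0"
    and lim: "(w' \<longlongrightarrow> 0) (at_left B)"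
    and s: "s \<in> {A<..<B}"
  shows "w s * w' s \<le> 0"
proof -
  have "A < B" using s by auto
  have ev: "eventually (\<lambda>t. \<bar>w' t\<bar> < 1) (at_left B)"
    using order_tendstoD(2)[OF tendsto_rabs_zero[OF lim], of 1] by simp
  then obtain d where d: "d < B" "\<And>t. d < t \<Longrightarrow> t < B \<Longrightarrow> \<bar>w' t\<bar> < 1"
    unfolding eventually_at_left_field by blast
  define u where "u = (max d A + B) / 2"
  have u: "d < u" "A < u" "u < B" using d(1) \<open>A < B\<close> by (auto simp: u_def)
  \<comment> \<open>\<open>w\<close> has no prescribed limit at \<open>B\<close>; the product
    \<open>w * w'\<close> still tends to 0 because \<open>w'\<close> is bounded near
    \<open>B\<close>, and hence so is \<open>w\<close>.\<close>
  have bd: "\<bar>w t\<bar> \<le> \<bar>w u\<bar> + (B - A)" if t: "u < t" "t < B" for t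
  proof -
    obtain z where z: "u < z" "z < t" "w t - w u = (t - u) * w' z"
      using MVT2[of u t w w'] w u t by fastforce
    have "\<bar>w' z\<bar> \<le> 1" using d(2)[of z] z u t by linarith
    then have "\<bar>w t - w u\<bar> \<le> (t - u) * 1"
      unfolding z(3) abs_mult using t by (intro mult_mono) auto
    then show ?thesis using u t abs_triangle_ineq2[of "w t" "w u"] by simp
  qed
  have "((\<lambda>t. w t * w' t) \<longlongrightarrow> 0) (at_left B)"
  proof (rule Lim_null_comparison)
    show "\<forall>\<^sub>F t in at_left B. norm (w t * w' t) \<le> (\<bar>w u\<bar> + (B - A)) * \<bar>w' t\<bar>"
      unfolding eventually_at_left_field
      by (rule exI[of _ u]) (use u bd in \<open>auto simp: abs_mult intro!: mult_right_mono\<close>)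
    show "((\<lambda>t. (\<bar>w u\<bar> + (B - A)) * \<bar>w' t\<bar>) \<longlongrightarrow> 0) (at_left B)"
      using tendsto_mult_right_zero[OF tendsto_rabs_zero[OF lim]] by simp
  qed
  moreover have "w s * w' s \<le> w t * w' t" if t: "s < t" "t < B" for t
  proof (rule DERIV_nonneg_imp_nondecreasing[where f = "\<lambda>x. w x * w' x"])
    fix x assume x: "s \<le> x" "x \<le> t"
    then have xx: "x \<in> {A<..<B}" using s t by auto
    have "((\<lambda>x. w x * w' x) has_real_derivative w' x * w' x + c x * w x * w x) (at x)"
      by (rule DERIV_mult[OF w[OF xx] w'[OF xx], THEN DERIV_cong]) (simp add: algebra_simps)
    moreover have "w' x * w' x + c x * w x * w x \<ge> 0"
      using c[OF xx] by (simp add: mult.assoc)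
    ultimately show "\<exists>y. ((\<lambda>a. w a * w' a) has_real_derivative y) (at x) \<and> 0 \<le> y" by blast
  qed (use t in auto)
  then have "eventually (\<lambda>t. w s * w' s \<le> w t * w' t) (at_left B)"
    unfolding eventually_at_left_field using s by (intro exI[of _ s]) auto
  ultimately show ?thesis
    by (rule tendsto_lowerbound) simp
qed

text \<open>The square of \<open>w\<close> has derivative \<open>2 * w * w'\<close>, which is
  nonpositive, so |w| is governed by its limit at \<open>A\<close>. The case \<open>e = 0\<close>
  gives uniqueness; \<open>e = \<delta>1 - \<delta>2\<close> compares two regularised
  solutions.\<close>

lemma energy_bound:
  fixes w w' c :: "real \<Rightarrow> real"
  assumes w: "\<And>s. s \<in> {A<..<B} \<Longrightarrow> (w has_real_derivative w' s) (at s)"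
    and w': "\<And>s. s \<in> {A<..<B} \<Longrightarrow> (w' has_real_derivative c s * w s) (at s)"
    and c: "\<And>s. s \<in> {A<..<B} \<Longrightarrow> c s \<ge> 0"
    and lim: "(w' \<longlongrightarrow> 0) (at_left B)"
    and limA: "(w \<longlongrightarrow> e) (at_right A)"
    and s: "s \<in> {A<..<B}"
  shows "\<bar>w s\<bar> \<le> \<bar>e\<bar>"
proof -
  have "(w s)\<^sup>2 \<le> (w t)\<^sup>2" if t: "A < t" "t < s" for t
  proof (rule DERIV_nonpos_imp_nonincreasing[where f = "\<lambda>x. (w x)\<^sup>2"])
    fix x assume x: "t \<le> x" "x \<le> s"
    then have xx: "x \<in> {A<..<B}" using s t by auto
    have "((\<lambda>x. (w x)\<^sup>2) has_real_derivative 2 * (w x * w' x)) (at x)"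
      using w[OF xx] by (auto intro!: derivative_eq_intros)
    moreover have "w x * w' x \<le> 0"
      by (rule energy_nonpos[OF w w' c lim xx])
    ultimately show "\<exists>y. ((\<lambda>a. (w a)\<^sup>2) has_real_derivative y) (at x) \<and> y \<le> 0"
      by (intro exI[of _ "2 * (w x * w' x)"]) auto
  qed (use t in auto)
  then have "eventually (\<lambda>t. (w s)\<^sup>2 \<le> (w t)\<^sup>2) (at_right A)"
    unfolding eventually_at_right_field using s by (intro exI[of _ s]) auto
  then have "(w s)\<^sup>2 \<le> e\<^sup>2"
    by (rule tendsto_lowerbound[OF tendsto_power[OF limA]]) simp
  then show ?thesis by (simp add: abs_le_square_iff)
qed

section \<open>The solution operator of -u'' = h with u(A) = 0 and u'(B) = 0\<close>

definition twice_integral :: "real \<Rightarrow> real \<Rightarrow> (real \<Rightarrow> real) \<Rightarrow> real \<Rightarrow> real" where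
  "twice_integral A B h x = integral {A..x} (\<lambda>y. integral {y..B} h)"

context
  fixes A B :: real and h :: "real \<Rightarrow> real"
  assumes cont: "continuous_on {A..B} h"
begin

lemma continuous_on_tail_integral: "continuous_on {A..B} (\<lambda>y. integral {y..B} h)"
  by (intro indefinite_integral_continuous_1' integrable_continuous_real cont)

lemma tail_integral_has_derivative:
  assumes "x \<in> {A<..<B}"
  shows "((\<lambda>y. integral {y..B} h) has_real_derivative - h x) (at x)"
  using integral_has_real_derivative'[OF cont, of x] assms by (simp add: at_within_Icc_at)

lemma tail_integral_tendsto:
  assumes "A < B"
  shows "((\<lambda>y. integral {y..B} h) \<longlongrightarrow> 0) (at_left B)"
proof -
  have "((\<lambda>y. integral {y..B} h) \<longlongrightarrow> integral {B..B} h) (at B within {A..B})"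
    using continuous_on_tail_integral assms unfolding continuous_on_def
    by (meson atLeastAtMost_iff less_imp_le order_refl)
  then show ?thesis using assms by (simp add: at_within_Icc_at_left)
qed

lemma continuous_on_twice_integral: "continuous_on {A..B} (twice_integral A B h)"
  unfolding twice_integral_def
  by (intro indefinite_integral_continuous_1 integrable_continuous_real continuous_on_tail_integral)

lemma twice_integral_has_derivative:
  assumes "x \<in> {A<..<B}"
  shows "(twice_integral A B h has_real_derivative integral {x..B} h) (at x)"
  using integral_has_real_derivative[OF continuous_on_tail_integral, of x] assms
  unfolding twice_integral_def by (simp add: at_within_Icc_at)

end

lemma tail_integral_mono:
  assumes "continuous_on {A..B} h" "continuous_on {A..B} g"
    and "\<And>x. x \<in> {A..B} \<Longrightarrow> h x \<le> g x" "y \<in> {A..B}"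
  shows "integral {y..B} h \<le> integral {y..B} (g :: real \<Rightarrow> real)"
  using assms by (intro integral_le integrable_continuous_real)
    (auto intro: continuous_on_subset)

lemma twice_integral_mono:
  assumes "continuous_on {A..B} h" "continuous_on {A..B} g"
    and "\<And>x. x \<in> {A..B} \<Longrightarrow> h x \<le> g x" "y \<in> {A..B}"
  shows "twice_integral A B h y \<le> twice_integral A B g y"
  unfolding twice_integral_def
proof (rule integral_le)
  show "(\<lambda>y. integral {y..B} h) integrable_on {A..y}" "(\<lambda>y. integral {y..B} g) integrable_on {A..y}"
    using continuous_on_tail_integral[OF assms(1)] continuous_on_tail_integral[OF assms(2)] assms(4)
    by (auto intro!: integrable_continuous_real intro: continuous_on_subset)
  fix x assume "x \<in> {A..y}"
  then show "integral {x..B} h \<le> integral {x..B} g"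
    using tail_integral_mono[OF assms(1,2,3), of x] assms(4) by auto
qed

lemma twice_integral_cmult: "twice_integral A B (\<lambda>x. k * h x) y = k * twice_integral A B h y"
  unfolding twice_integral_def by simp

lemma twice_integral_nonneg:
  assumes "continuous_on {A..B} h" "\<And>x. x \<in> {A..B} \<Longrightarrow> h x \<ge> 0" "y \<in> {A..B}"
  shows "twice_integral A B h y \<ge> 0"
  using twice_integral_mono[of A B "\<lambda>_. 0" h y] assms by (simp add: twice_integral_def)

subsection \<open>The regularised boundary value problem\<close>

text \<open>Only \<open>\<psi> x \<ge> 0\<close> is asked for, because the intended \<psi> vanishes
  at the interior point 0 that represents the front.\<close>

locale singular_bvp =
  fixes A B :: real and \<psi> :: "real \<Rightarrow> real"
  assumes AB: "A < B"
    and psi_cont: "continuous_on {A..B} \<psi>"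
    and psi_nonneg: "\<And>x. x \<in> {A..B} \<Longrightarrow> \<psi> x \<ge> 0"
begin

definition source :: "(real \<Rightarrow> real) \<Rightarrow> real \<Rightarrow> real" where
  "source q t = \<psi> t / (2 * q t)"

text \<open>A positive fixed point solves q'' = -\<psi> / (2 q) with q(A) = \<delta> and q'(B) =
  0.\<close>

definition reg_step :: "real \<Rightarrow> (real \<Rightarrow> real) \<Rightarrow> real \<Rightarrow> real" where
  "reg_step \<delta> q x = \<delta> + twice_integral A B (source q) x"

text \<open>The domain on which \<open>reg_step\<close> acts: the lower bound \<delta> keeps the
  denominator of \<open>source\<close> away from 0 and is inherited by the image.\<close>

definition above :: "real \<Rightarrow> (real \<Rightarrow> real) \<Rightarrow> bool" where
  "above \<delta> q \<longleftrightarrow> continuous_on {A..B} q \<and> (\<forall>x\<in>{A..B}. \<delta> \<le> q x)"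

lemma source_cont: "continuous_on {A..B} (source q)" if "above \<delta> q" "\<delta> > 0"
  using that unfolding source_def above_def
  by (intro continuous_intros psi_cont) force+

lemma source_nonneg: "source q x \<ge> 0" if "above \<delta> q" "\<delta> > 0" "x \<in> {A..B}"
  using that psi_nonneg[of x] unfolding source_def above_def by (auto intro!: divide_nonneg_nonneg dest!: bspec)

text \<open>With \<open>l = 1\<close> this is the order reversal behind the upper bound on
  \<open>reg_step\<close>; with larger \<open>l\<close> it transports a ratio bound, exchanging the
  two functions.\<close>

lemma source_antimono:
  assumes "0 < q x" "q x \<le> l * p x" "0 < p x" "x \<in> {A..B}"
  shows "source p x \<le> l * source q x"
proof -
  have "\<psi> x * q x \<le> \<psi> x * (l * p x)"
    using assms psi_nonneg[of x] by (intro mult_left_mono) auto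
  then show ?thesis using assms by (simp add: source_def field_simps)
qed

lemma reg_step_above: "above \<delta> (reg_step \<delta> q)" if "above \<delta> q" "\<delta> > 0"
  unfolding above_def reg_step_def
  by (auto intro!: continuous_intros continuous_on_twice_integral source_cont[OF that]
      twice_integral_nonneg source_nonneg[OF that])

text \<open>As \<open>reg_step\<close> reverses the order, its largest values are attained at the
  smallest admissible function, the constant \<delta>. The strict inequality
  \<open>M > \<delta>\<close> makes \<open>1 - \<delta> / M\<close> a positive contraction
  factor.\<close>

lemma reg_step_bounded:
  assumes "\<delta> > 0"
  obtains M where "M > \<delta>" "\<And>q x. above \<delta> q \<Longrightarrow> x \<in> {A..B} \<Longrightarrow> reg_step \<delta> q x \<le> M"
proof -
  have ab: "above \<delta> (\<lambda>_. \<delta>)" by (simp add: above_def)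
  have "compact (twice_integral A B (source (\<lambda>_. \<delta>)) ` {A..B})"
    by (intro compact_continuous_image continuous_on_twice_integral source_cont[OF ab] assms) auto
  then obtain K where K: "\<And>x. x \<in> {A..B} \<Longrightarrow> \<bar>twice_integral A B (source (\<lambda>_. \<delta>)) x\<bar> \<le> K"
    using compact_imp_bounded bounded_iff by (metis imageI real_norm_def)
  show ?thesis
  proof (rule that[of "\<delta> + \<bar>K\<bar> + 1"])
    fix q x assume q: "above \<delta> q" and x: "x \<in> {A..B}"
    have "twice_integral A B (source q) x \<le> twice_integral A B (source (\<lambda>_. \<delta>)) x"
    proof (rule twice_integral_mono[OF source_cont[OF q assms] source_cont[OF ab assms] _ x])
      show "source q y \<le> source (\<lambda>_. \<delta>) y" if "y \<in> {A..B}" for y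
        using source_antimono[of "\<lambda>_. \<delta>" y 1 q] assms q that unfolding above_def by force
    qed
    then show "reg_step \<delta> q x \<le> \<delta> + \<bar>K\<bar> + 1"
      using K[OF x] unfolding reg_step_def by linarith
  qed auto
qed

text \<open>The map \<open>q \<mapsto> source q\<close> is homogeneous of degree \<open>-1\<close>, so the twice integrated source
  only preserves ratios; the constant \<open>\<delta>\<close> makes the map contract them.\<close>

lemma reg_step_contracts:
  assumes d: "\<delta> > 0" and q: "above \<delta> q" and p: "above \<delta> p" and l: "l \<ge> 1"
    and le: "\<And>x. x \<in> {A..B} \<Longrightarrow> q x \<le> l * p x"
    and M: "\<And>x. x \<in> {A..B} \<Longrightarrow> reg_step \<delta> q x \<le> M" and x: "x \<in> {A..B}"
  shows "reg_step \<delta> p x \<le> (1 + (l - 1) * (1 - \<delta> / M)) * reg_step \<delta> q x"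
proof -
  have "twice_integral A B (source p) x \<le> twice_integral A B (\<lambda>t. l * source q t) x"
  proof (rule twice_integral_mono[OF source_cont[OF p d] _ _ x])
    show "continuous_on {A..B} (\<lambda>t. l * source q t)"
      by (intro continuous_intros source_cont[OF q d])
    show "source p y \<le> l * source q y" if "y \<in> {A..B}" for y
      using source_antimono[of q y l p] le[OF that] d p q that unfolding above_def by force
  qed
  then have "reg_step \<delta> p x \<le> l * reg_step \<delta> q x - (l - 1) * \<delta>"
    unfolding twice_integral_cmult reg_step_def by (simp add: algebra_simps)
  \<comment> \<open>The summand \<delta> is not multiplied by \<open>l\<close>, which saves
    \<open>(l - 1) * \<delta>\<close>; since \<open>reg_step \<delta> q x \<le> M\<close>, this is
    at least the fraction \<open>\<delta> / M\<close> of
    \<open>(l - 1) * reg_step \<delta> q x\<close>.\<close>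
  moreover have "(l - 1) * (\<delta> / M * reg_step \<delta> q x) \<le> (l - 1) * \<delta>"
  proof (intro mult_left_mono)
    have "\<delta> \<le> reg_step \<delta> q x" using reg_step_above[OF q d] x by (simp add: above_def)
    then have "M > 0" using M[OF x] d by linarith
    then show "\<delta> / M * reg_step \<delta> q x \<le> \<delta>" using M[OF x] d by (simp add: field_simps)
  qed (use l in auto)
  ultimately show ?thesis by (simp add: algebra_simps)
qed

text \<open>Picard iteration from the constant \<delta>. The excess over 1 of the ratio of
  consecutive iterates decays geometrically; as all iterates lie between \<delta> and
  \<open>M\<close>, this becomes geometric decay of their differences, and the telescoping series
  converges uniformly.\<close>

lemma regularised_solution:
  assumes d: "\<delta> > 0"
  obtains q where "above \<delta> q" "\<And>x. x \<in> {A..B} \<Longrightarrow> q x = reg_step \<delta> q x"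
proof -
  obtain M where M: "M > \<delta>" "\<And>q x. above \<delta> q \<Longrightarrow> x \<in> {A..B} \<Longrightarrow> reg_step \<delta> q x \<le> M"
    using reg_step_bounded[OF d] by metis
  define u where "u n = (reg_step \<delta> ^^ n) (\<lambda>_. \<delta>)" for n
  have u_Suc: "u (Suc n) = reg_step \<delta> (u n)" for n by (simp add: u_def)
  have u_above: "above \<delta> (u n)" for n
  proof (induction n)
    case 0 then show ?case by (simp add: u_def above_def)
  next
    case (Suc n) then show ?case unfolding u_Suc by (rule reg_step_above[OF _ d])
  qed
  have u_le: "u n x \<le> M" if "x \<in> {A..B}" for n x
  proof (cases n)
    case 0 then show ?thesis using M(1) by (simp add: u_def)
  next
    case (Suc m) then show ?thesis using M(2)[OF u_above that] by (simp add: u_Suc)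
  qed
  have u_ge: "\<delta> \<le> u n x" if "x \<in> {A..B}" for n x
    using u_above[of n] that by (simp add: above_def)
  define k where "k = 1 - \<delta> / M"
  have k: "0 < k" "k < 1" using d M(1) by (auto simp: k_def)
  \<comment> \<open>\<open>1 + c = M / \<delta>\<close> bounds the ratio of any two functions with
    values between \<delta> and \<open>M\<close>, which starts the induction.\<close>
  define c where "c = M / \<delta> - 1"
  have c: "c \<ge> 0" using d M(1) by (simp add: c_def)
  \<comment> \<open>Both inequalities are carried along because the order-reversing map turns each
    one into the other.\<close>
  have ratio: "u (Suc n) x \<le> (1 + c * k ^ n) * u n x \<and> u n x \<le> (1 + c * k ^ n) * u (Suc n) x"
    if "x \<in> {A..B}" for n x using that
  proof (induction n arbitrary: x)
    case 0
    have "M \<le> M / \<delta> * u n x" for n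
      using u_ge[OF 0, of n] d M(1) by (simp add: field_simps)
    then show ?case using u_le[OF 0] by (auto simp: c_def intro: order_trans)
  next
    case (Suc n)
    have "1 + c * k ^ n \<ge> 1" using c k by simp
    note step = reg_step_contracts[OF d u_above u_above this _ M(2)[OF u_above] Suc.prems]
    show ?case
      using step[of n "Suc n"] step[of "Suc n" n] Suc.IH
      by (simp add: u_Suc k_def mult_ac)
  qed
  define D where "D n x = u (Suc n) x - u n x" for n x
  have diff: "norm (D n x) \<le> (c * M) * k ^ n" if x: "x \<in> {A..B}" for n x
  proof -
    have "c * k ^ n * u m x \<le> c * k ^ n * M" for m
      using u_le[OF x, of m] c k by (intro mult_left_mono) auto
    from this[of n] this[of "Suc n"] ratio[OF x, of n] show ?thesis
      by (simp add: D_def algebra_simps abs_le_iff)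
  qed
  have "summable (\<lambda>n. (c * M) * k ^ n)" using k by (intro summable_mult summable_geometric) auto
  with diff have "uniform_limit {A..B} (\<lambda>n x. \<Sum>i<n. D i x) (\<lambda>x. suminf (\<lambda>i. D i x)) sequentially"
    by (rule Weierstrass_m_test)
  then have "uniform_limit {A..B} (\<lambda>n x. (\<Sum>i<n. D i x) + u 0 x)
      (\<lambda>x. suminf (\<lambda>i. D i x) + u 0 x) sequentially"
    by (intro uniform_limit_add uniform_limit_const)
  moreover have "(\<Sum>i<n. D i x) + u 0 x = u n x" for n x
    using sum_lessThan_telescope[of "\<lambda>i. u i x" n] by (simp add: D_def)
  ultimately obtain v where v: "uniform_limit {A..B} u v sequentially"
    by auto
  have lim: "(\<lambda>n. u n x) \<longlonglongrightarrow> v x" if "x \<in> {A..B}" for x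
    using tendsto_uniform_limitI[OF v that] .
  have v_above: "above \<delta> v"
    unfolding above_def
  proof (intro conjI ballI)
    show "continuous_on {A..B} v"
      by (rule uniform_limit_theorem[OF _ v]) (use u_above in \<open>auto simp: above_def\<close>)
    show "\<delta> \<le> v x" if "x \<in> {A..B}" for x
      by (rule LIMSEQ_le_const[OF lim[OF that]]) (use u_ge that in auto)
  qed
  show ?thesis
  proof (rule that[OF v_above])
    fix x assume x: "x \<in> {A..B}"
    \<comment> \<open>The fixed point equation is also obtained through ratios: a uniform error
      below \<open>e * \<delta>\<close> is at most a fraction \<open>e\<close> of any value, so
      \<open>u n\<close> and \<open>v\<close> have ratio at most \<open>1 + e\<close>, their images
      at most \<open>1 + e * k\<close>, and finally \<open>e\<close> tends to 0.\<close>
    have *: "v x \<le> (1 + e * k) * reg_step \<delta> v x \<and> reg_step \<delta> v x \<le> (1 + e * k) * v x"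
      if e: "e > 0" for e
    proof -
      have "eventually (\<lambda>n. \<forall>y\<in>{A..B}. dist (u n y) (v y) < e * \<delta>) sequentially"
        using uniform_limitD[OF v, of "e * \<delta>"] d e by simp
      then have ev: "eventually (\<lambda>n. u (Suc n) x \<le> (1 + e * k) * reg_step \<delta> v x \<and>
          reg_step \<delta> v x \<le> (1 + e * k) * u (Suc n) x) sequentially"
      proof eventually_elim
        case (elim n)
        have "u n y \<le> (1 + e) * v y \<and> v y \<le> (1 + e) * u n y" if y: "y \<in> {A..B}" for y
        proof -
          have "e * \<delta> \<le> e * u n y" "e * \<delta> \<le> e * v y"
            using u_ge[OF y, of n] v_above y e by (auto simp: above_def)
          moreover have "\<bar>u n y - v y\<bar> < e * \<delta>" using elim y by (auto simp: dist_real_def)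
          ultimately show ?thesis by (auto simp: algebra_simps abs_less_iff)
        qed
        moreover have "1 \<le> 1 + e" using e by simp
        ultimately show ?case
          using reg_step_contracts[OF d u_above v_above _ _ M(2)[OF u_above] x, of "1 + e" n]
            reg_step_contracts[OF d v_above u_above _ _ M(2)[OF v_above] x, of "1 + e" n]
          by (simp add: u_Suc k_def)
      qed
      have l: "(\<lambda>n. u (Suc n) x) \<longlonglongrightarrow> v x" using lim[OF x] by (rule LIMSEQ_Suc)
      have "v x \<le> (1 + e * k) * reg_step \<delta> v x"
        by (rule tendsto_upperbound[OF l]) (use ev in \<open>auto elim: eventually_mono\<close>)
      moreover have "reg_step \<delta> v x \<le> (1 + e * k) * v x"
        by (rule tendsto_lowerbound[OF tendsto_mult_left[OF l]]) (use ev in \<open>auto elim: eventually_mono\<close>)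
      ultimately show ?thesis ..
    qed
    have pos: "((\<lambda>e. (1 + e * k) * y) \<longlongrightarrow> (1 + 0 * k) * y) (at_right 0)" for y
      by (intro tendsto_intros)
    have ev0: "eventually (\<lambda>e::real. e > 0) (at_right 0)" by (rule eventually_at_right_less)
    have "eventually (\<lambda>e. v x \<le> (1 + e * k) * reg_step \<delta> v x) (at_right 0)"
      "eventually (\<lambda>e. reg_step \<delta> v x \<le> (1 + e * k) * v x) (at_right 0)"
      using ev0 by (eventually_elim, use * in blast)+
    then show "v x = reg_step \<delta> v x"
      using tendsto_lowerbound[OF pos[of "reg_step \<delta> v x"], of "v x"]
        tendsto_lowerbound[OF pos[of "v x"], of "reg_step \<delta> v x"]
      by (intro antisym) simp_all
  qed
qed

end

subsection \<open>The singular problem in the hodograph variable\<close>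

text \<open>The second-order equation is written as a system because \<open>2 * p\<close> is the
  position \<eta> as a function of the value \<open>s\<close>. Boundary values are limits, since the
  equation is singular at \<open>A\<close>, where \<open>q\<close> tends to 0.\<close>

definition hodograph ::
  "real \<Rightarrow> real \<Rightarrow> (real \<Rightarrow> real) \<Rightarrow> (real \<Rightarrow> real) \<Rightarrow> (real \<Rightarrow> real) \<Rightarrow> bool" where
  "hodograph A B \<psi> q p \<longleftrightarrow>
     (\<forall>s\<in>{A<..<B}. q s > 0 \<and> (q has_real_derivative p s) (at s) \<and>
        (p has_real_derivative - (\<psi> s / (2 * q s))) (at s)) \<and>
     (q \<longlongrightarrow> 0) (at_right A) \<and> (p \<longlongrightarrow> 0) (at_left B)"

lemma hodographD:
  assumes "hodograph A B \<psi> q p"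
  shows "s \<in> {A<..<B} \<Longrightarrow> q s > 0"
    and "s \<in> {A<..<B} \<Longrightarrow> (q has_real_derivative p s) (at s)"
    and "s \<in> {A<..<B} \<Longrightarrow> (p has_real_derivative - (\<psi> s / (2 * q s))) (at s)"
    and "(q \<longlongrightarrow> 0) (at_right A)" and "(p \<longlongrightarrow> 0) (at_left B)"
  using assms by (auto simp: hodograph_def)

text \<open>Subtracting the reciprocals leaves the factor \<open>q1 s - q2 s\<close> with a
  coefficient that is nonnegative when \<psi> is: exactly the form the energy estimate asks
  for.\<close>

lemma source_difference:
  fixes \<psi> q1 q2 p1 p2 :: "real \<Rightarrow> real"
  assumes "q1 s > 0" "q2 s > 0"
    and "(p1 has_real_derivative - (\<psi> s / (2 * q1 s))) (at s)"
    and "(p2 has_real_derivative - (\<psi> s / (2 * q2 s))) (at s)"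
  shows "((\<lambda>s. p1 s - p2 s) has_real_derivative \<psi> s / (2 * q1 s * q2 s) * (q1 s - q2 s)) (at s)"
  by (rule DERIV_diff[OF assms(3,4), THEN DERIV_cong]) (use assms in \<open>simp add: field_simps\<close>)

text \<open>The energy bound with \<open>e = 0\<close> identifies \<open>q1\<close> and
  \<open>q2\<close>, hence their derivatives. The conclusion is about \<open>p\<close> because
  \<open>p\<close> determines the solution and its front.\<close>

lemma hodograph_unique:
  assumes "hodograph A B \<psi> q1 p1" "hodograph A B \<psi> q2 p2"
    and nonneg: "\<And>s. s \<in> {A<..<B} \<Longrightarrow> \<psi> s \<ge> 0" and s: "s \<in> {A<..<B}"
  shows "p1 s = p2 s"
proof -
  note h1 = hodographD[OF assms(1)] and h2 = hodographD[OF assms(2)]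
  have eq: "q1 t = q2 t" if t: "t \<in> {A<..<B}" for t
  proof -
    have "\<bar>q1 t - q2 t\<bar> \<le> \<bar>0 - 0\<bar>"
    proof (rule energy_bound[OF _ _ _ _ _ t])
      show "((\<lambda>s. q1 s - q2 s) has_real_derivative p1 s - p2 s) (at s)"
        if "s \<in> {A<..<B}" for s
        using h1(2) h2(2) that by (intro DERIV_diff) auto
      show "((\<lambda>s. p1 s - p2 s) has_real_derivative \<psi> s / (2 * q1 s * q2 s) * (q1 s - q2 s)) (at s)"
        if "s \<in> {A<..<B}" for s
        using h1 h2 that by (intro source_difference) auto
      show "0 \<le> \<psi> s / (2 * q1 s * q2 s)" if "s \<in> {A<..<B}" for s
        using h1(1)[OF that] h2(1)[OF that] nonneg[OF that] by simp
      show "((\<lambda>s. p1 s - p2 s) \<longlongrightarrow> 0) (at_left B)"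
        using tendsto_diff[OF h1(5) h2(5)] by simp
      show "((\<lambda>s. q1 s - q2 s) \<longlongrightarrow> 0 - 0) (at_right A)"
        by (rule tendsto_diff[OF h1(4) h2(4)])
    qed
    then show ?thesis by simp
  qed
  have "(q2 has_real_derivative p1 s) (at s)"
    by (rule has_field_derivative_transform_within_open[OF h1(2)[OF s] _ s]) (use eq in auto)
  then show ?thesis using h2(2)[OF s] DERIV_unique by blast
qed

section \<open>The singular problem as a limit of regularised ones\<close>

context singular_bvp
begin

lemma above_pos: "above \<delta> q \<Longrightarrow> \<delta> > 0 \<Longrightarrow> x \<in> {A..B} \<Longrightarrow> q x > 0"
  unfolding above_def by force

lemma reg_fixpoint_derivs:
  assumes d: "\<delta> > 0" and q: "above \<delta> q" "\<And>x. x \<in> {A..B} \<Longrightarrow> q x = reg_step \<delta> q x"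
  shows "x \<in> {A<..<B} \<Longrightarrow> (q has_real_derivative integral {x..B} (source q)) (at x)"
    and "x \<in> {A<..<B} \<Longrightarrow>
      ((\<lambda>x. integral {x..B} (source q)) has_real_derivative - (\<psi> x / (2 * q x))) (at x)"
    and "((\<lambda>x. integral {x..B} (source q)) \<longlongrightarrow> 0) (at_left B)"
    and "q A = \<delta>" and "(q \<longlongrightarrow> \<delta>) (at_right A)"
proof -
  note c = source_cont[OF q(1) d]
  show "(q has_real_derivative integral {x..B} (source q)) (at x)" if x: "x \<in> {A<..<B}"
  proof (rule has_field_derivative_transform_within_open[where S = "{A<..<B}"])
    show "(reg_step \<delta> q has_real_derivative integral {x..B} (source q)) (at x)"
      unfolding reg_step_def using twice_integral_has_derivative[OF c x]
      by (auto intro!: derivative_eq_intros)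
  qed (use x q(2) in auto)
  show "((\<lambda>x. integral {x..B} (source q)) has_real_derivative - (\<psi> x / (2 * q x))) (at x)"
    if "x \<in> {A<..<B}"
    using tail_integral_has_derivative[OF c that] by (simp add: source_def)
  show "((\<lambda>x. integral {x..B} (source q)) \<longlongrightarrow> 0) (at_left B)"
    by (rule tail_integral_tendsto[OF c AB])
  show qA: "q A = \<delta>" using q(2)[of A] AB by (simp add: reg_step_def twice_integral_def)
  have "(q \<longlongrightarrow> q A) (at A within {A..B})"
    using q(1) AB by (auto simp: above_def continuous_on_def)
  then show "(q \<longlongrightarrow> \<delta>) (at_right A)" using AB qA by (simp add: at_within_Icc_at_right)
qed

text \<open>The energy bound with \<open>e = \<delta>1 - \<delta>2\<close> holds inside the interval
  and extends to its ends by continuity. It makes the regularised solutions uniformly Cauchy as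
  \<delta> tends to 0.\<close>

lemma reg_fixpoints_close:
  assumes d: "\<delta>1 > 0" "\<delta>2 > 0"
    and q1: "above \<delta>1 q1" "\<And>x. x \<in> {A..B} \<Longrightarrow> q1 x = reg_step \<delta>1 q1 x"
    and q2: "above \<delta>2 q2" "\<And>x. x \<in> {A..B} \<Longrightarrow> q2 x = reg_step \<delta>2 q2 x"
    and x: "x \<in> {A..B}"
  shows "\<bar>q1 x - q2 x\<bar> \<le> \<bar>\<delta>1 - \<delta>2\<bar>"
proof -
  note h1 = reg_fixpoint_derivs[OF d(1) q1] and h2 = reg_fixpoint_derivs[OF d(2) q2]
  have pos: "q1 s > 0" "q2 s > 0" if "s \<in> {A<..<B}" for s
    using above_pos[OF q1(1) d(1), of s] above_pos[OF q2(1) d(2), of s] that by auto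
  have int: "\<bar>q1 t - q2 t\<bar> \<le> \<bar>\<delta>1 - \<delta>2\<bar>" if t: "t \<in> {A<..<B}" for t
  proof (rule energy_bound[OF _ _ _ _ _ t])
    show "((\<lambda>s. q1 s - q2 s) has_real_derivative
        integral {s..B} (source q1) - integral {s..B} (source q2)) (at s)"
      if "s \<in> {A<..<B}" for s
      using h1(1) h2(1) that by (intro DERIV_diff) auto
    show "((\<lambda>s. integral {s..B} (source q1) - integral {s..B} (source q2)) has_real_derivative
        \<psi> s / (2 * q1 s * q2 s) * (q1 s - q2 s)) (at s)"
      if "s \<in> {A<..<B}" for s
      using h1 h2 that pos by (intro source_difference) auto
    show "0 \<le> \<psi> s / (2 * q1 s * q2 s)" if "s \<in> {A<..<B}" for s
      using pos[OF that] psi_nonneg[of s] that by simp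
    show "((\<lambda>s. integral {s..B} (source q1) - integral {s..B} (source q2)) \<longlongrightarrow> 0) (at_left B)"
      using tendsto_diff[OF h1(3) h2(3)] by simp
    show "((\<lambda>s. q1 s - q2 s) \<longlongrightarrow> \<delta>1 - \<delta>2) (at_right A)"
      by (rule tendsto_diff[OF h1(5) h2(5)])
  qed
  have "continuous_on {A..B} (\<lambda>x. \<bar>q1 x - q2 x\<bar>)"
    using q1(1) q2(1) unfolding above_def by (auto intro!: continuous_intros)
  then show ?thesis
    using continuous_le_on_closure[of "{A<..<B}" "\<lambda>x. \<bar>q1 x - q2 x\<bar>" x] int x AB by simp
qed

text \<open>The uniform limit solves the equation once it is known to be positive on
  \<open>(A, B]\<close>. For this \<open>\<psi> B > 0\<close> suffices: the mass of \<psi> near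
  \<open>B\<close> enters every tail integral, so the lower bound \<open>lb\<close> is
  positive.\<close>

lemma hodograph_exists:
  assumes psiB: "\<psi> B > 0"
  obtains q p where "hodograph A B \<psi> q p"
proof -
  define \<delta> where "\<delta> n = inverse (real (Suc n))" for n
  have d: "\<delta> n > 0" for n by (simp add: \<delta>_def)
  have d_lim: "\<delta> \<longlonglongrightarrow> 0" unfolding \<delta>_def by (rule LIMSEQ_inverse_real_of_nat)
  have "\<forall>n. \<exists>q. above (\<delta> n) q \<and> (\<forall>x\<in>{A..B}. q x = reg_step (\<delta> n) q x)"
    using regularised_solution[OF d] by metis
  then obtain Q where Q: "\<And>n. above (\<delta> n) (Q n)"
    and Q_fix: "\<And>n x. x \<in> {A..B} \<Longrightarrow> Q n x = reg_step (\<delta> n) (Q n) x"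
    by metis
  note der = reg_fixpoint_derivs[OF d Q Q_fix]
  have Q_cont: "continuous_on {A..B} (Q n)" for n using Q by (simp add: above_def)
  have close: "\<bar>Q n x - Q m x\<bar> \<le> \<bar>\<delta> n - \<delta> m\<bar>" if "x \<in> {A..B}" for n m x
    by (rule reg_fixpoints_close[OF d d Q Q_fix Q Q_fix that])
  have "uniformly_Cauchy_on {A..B} Q"
    unfolding uniformly_Cauchy_on_def
  proof (intro allI impI)
    fix e :: real assume "e > 0"
    then obtain M where "\<And>m n. m \<ge> M \<Longrightarrow> n \<ge> M \<Longrightarrow> \<bar>\<delta> m - \<delta> n\<bar> < e"
      using LIMSEQ_imp_Cauchy[OF d_lim] unfolding Cauchy_def dist_real_def by metis
    then show "\<exists>M. \<forall>x\<in>{A..B}. \<forall>m\<ge>M. \<forall>n\<ge>M. dist (Q m x) (Q n x) < e"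
      using close unfolding dist_real_def by (meson le_less_trans)
  qed
  then obtain q where q_lim: "uniform_limit {A..B} Q q sequentially"
    using Cauchy_uniformly_convergent unfolding uniformly_convergent_on_def by blast
  have q_ptw: "(\<lambda>n. Q n x) \<longlonglongrightarrow> q x" if "x \<in> {A..B}" for x
    using tendsto_uniform_limitI[OF q_lim that] .
  have q_cont: "continuous_on {A..B} q"
    by (rule uniform_limit_theorem[OF _ q_lim]) (use Q_cont in auto)
  have "bounded (Q 0 ` {A..B})"
    using Q_cont by (intro compact_imp_bounded compact_continuous_image) auto
  then obtain K where "\<forall>y\<in>Q 0 ` {A..B}. \<bar>y\<bar> \<le> K"
    unfolding bounded_iff real_norm_def by blast
  then have K: "\<bar>Q 0 x\<bar> \<le> K" if "x \<in> {A..B}" for x using that by blast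
  \<comment> \<open>The \<open>1\<close> absorbs the distance of \<open>Q n\<close> from
    \<open>Q 0\<close>, which is at most
    \<open>\<bar>\<delta> n - \<delta> 0\<bar> \<le> 1\<close>.\<close>
  define M where "M = K + 1"
  have Q_le: "Q n x \<le> M" if "x \<in> {A..B}" for n x
  proof -
    have "\<bar>\<delta> n - \<delta> 0\<bar> \<le> 1" unfolding \<delta>_def by (simp add: field_simps)
    then show ?thesis using close[OF that, of n 0] K[OF that] unfolding M_def by linarith
  qed
  have M: "M > 0" using Q_le[of A 0] above_pos[OF Q d, of A 0] AB by simp
  \<comment> \<open>\<open>Q n \<le> M\<close> makes the source at least
    \<open>\<psi> t / (2 * M)\<close>; integrating twice bounds every \<open>Q n\<close> below,
    independently of \<open>n\<close>.\<close>
  define lb where "lb = twice_integral A B (\<lambda>t. \<psi> t / (2 * M))"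
  have l_cont: "continuous_on {A..B} (\<lambda>t. \<psi> t / (2 * M))"
    using M by (intro continuous_intros psi_cont) auto
  have l_nonneg: "0 \<le> \<psi> t / (2 * M)" if "t \<in> {A..B}" for t
    using psi_nonneg[OF that] M by simp
  have tail_nonneg: "0 \<le> integral {y..B} (\<lambda>t. \<psi> t / (2 * M))" if "y \<in> {A..B}" for y
    using l_nonneg l_cont that
    by (intro integral_nonneg integrable_continuous_real) (auto intro: continuous_on_subset)
  have tail_cont: "continuous_on {A..x} (\<lambda>y. integral {y..B} (\<lambda>t. \<psi> t / (2 * M)))" if "x \<le> B" for x
    using continuous_on_tail_integral[OF l_cont] that by (auto intro: continuous_on_subset)
  have l_pos: "lb x > 0" if x: "A < x" "x \<le> B" for x
  proof -
    have "lb x \<ge> 0" using twice_integral_nonneg[OF l_cont l_nonneg] x by (simp add: lb_def)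
    moreover have "lb x \<noteq> 0"
    proof
      assume "lb x = 0"
      then have "integral {A..B} (\<lambda>t. \<psi> t / (2 * M)) = 0"
        using integral_eq_0_iff[OF tail_cont[OF x(2)] x(1)] tail_nonneg x
        unfolding lb_def twice_integral_def by auto
      then have "\<psi> B / (2 * M) = 0"
        using integral_eq_0_iff[OF l_cont AB l_nonneg] AB by auto
      then show False using psiB M by simp
    qed
    ultimately show ?thesis by simp
  qed
  have l_mono: "lb x \<le> lb y" if "A \<le> x" "x \<le> y" "y \<le> B" for x y
    unfolding lb_def twice_integral_def using that tail_nonneg
    by (intro integral_subset_le integrable_continuous_real tail_cont) auto
  have Q_ge: "lb x \<le> Q n x" if x: "x \<in> {A..B}" for n x
  proof -
    have "lb x \<le> twice_integral A B (source (Q n)) x"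
      unfolding lb_def
    proof (rule twice_integral_mono[OF l_cont source_cont[OF Q d] _ x])
      show "\<psi> t / (2 * M) \<le> source (Q n) t" if "t \<in> {A..B}" for t
        unfolding source_def using Q_le[OF that, of n] above_pos[OF Q d that, of n] psi_nonneg[OF that]
        by (intro divide_left_mono) auto
    qed
    then show ?thesis using Q_fix[OF x, of n] d[of n] by (simp add: reg_step_def)
  qed
  have q_ge: "lb x \<le> q x" if "x \<in> {A..B}" for x
    by (rule LIMSEQ_le_const[OF q_ptw[OF that]]) (use Q_ge[OF that] in auto)
  have q_pos: "q x > 0" if "A < x" "x \<le> B" for x
    using q_ge[of x] l_pos[of x] that by auto
  define p where "p x = integral {x..B} (source q)" for x
  have src_cont: "continuous_on {x..B} (source q)" if "A < x" for x
  proof -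
    have "2 * q t \<noteq> 0" if "t \<in> {x..B}" for t
      using q_pos[of t] that \<open>A < x\<close> by simp
    then show ?thesis
      unfolding source_def using that
      by (intro continuous_intros continuous_on_subset[OF q_cont] continuous_on_subset[OF psi_cont]) auto
  qed
  have p_der: "(p has_real_derivative - (\<psi> s / (2 * q s))) (at s)" if s: "s \<in> {A<..<B}" for s
  proof -
    have "A < (A + s) / 2" "s \<in> {(A + s) / 2<..<B}" using s by auto
    from tail_integral_has_derivative[OF src_cont[OF this(1)] this(2)]
    show ?thesis unfolding p_def[abs_def] by (simp add: source_def)
  qed
  have q_der: "(q has_real_derivative p s) (at s)" if s: "s \<in> {A<..<B}" for s
  proof -
    \<comment> \<open>Away from the singular end the denominators are at least
      \<open>2 * lb x > 0\<close>, so the sources, and with them the derivatives of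
      \<open>Q n\<close>, converge uniformly on \<open>{x<..<B}\<close>.\<close>
    define x where "x = (A + s) / 2"
    have x: "A < x" "x < s" "s < B" using s by (auto simp: x_def)
    have "uniform_limit {x..B} (\<lambda>n t. \<psi> t / (2 * Q n t)) (\<lambda>t. \<psi> t / (2 * q t)) sequentially"
    proof (rule uniform_lim_divide)
      show "uniform_limit {x..B} (\<lambda>n. \<psi>) \<psi> sequentially" by (rule uniform_limit_const)
      show "bounded (\<psi> ` {x..B})"
        by (intro compact_imp_bounded compact_continuous_image continuous_on_subset[OF psi_cont])
          (use x in auto)
      show "2 * lb x \<le> norm (2 * q t)" if "t \<in> {x..B}" for t
        using l_mono[of x t] q_ge[of t] that x by auto
      show "uniform_limit {x..B} (\<lambda>n t. 2 * Q n t) (\<lambda>t. 2 * q t) sequentially"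
        by (intro bounded_linear.uniform_limit[OF bounded_linear_mult_right]
            uniform_limit_on_subset[OF q_lim]) (use x in auto)
    qed (use l_pos x in auto)
    then have src: "uniform_limit {x..B} (\<lambda>n. source (Q n)) (source q) sequentially"
      by (simp add: source_def[abs_def])
    have ev: "\<forall>\<^sub>F n in sequentially. \<forall>y\<in>{x<..<B}. \<forall>h.
        norm (integral {y..B} (source (Q n)) * h - p y * h) \<le> e * norm h" if "e > 0" for e
    proof -
      define e' where "e' = e / (B - x)"
      have "e' > 0" using that x by (simp add: e'_def)
      from uniform_limitD[OF src this] show ?thesis
      proof eventually_elim
        case (elim n)
        have "norm (integral {y..B} (source (Q n)) - p y) \<le> e" if y: "y \<in> {x<..<B}" for y
        proof -
          have c: "continuous_on {y..B} (source (Q n))" "continuous_on {y..B} (source q)"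
            using source_cont[OF Q d, of n] src_cont[of y] x y by (auto intro: continuous_on_subset)
          have "integral {y..B} (source (Q n)) - p y = integral {y..B} (\<lambda>t. source (Q n) t - source q t)"
            unfolding p_def by (rule integral_diff[symmetric]) (intro integrable_continuous_real c)+
          moreover have "norm (integral {y..B} (\<lambda>t. source (Q n) t - source q t)) \<le> e' * (B - y)"
            using elim y by (intro integral_bound continuous_intros c) (auto simp: dist_norm less_imp_le)
          moreover have "e' * (B - y) \<le> e' * (B - x)"
            using \<open>e' > 0\<close> y by (intro mult_left_mono) auto
          ultimately show ?thesis using x by (simp add: e'_def)
        qed
        then show ?case
          by (auto simp: abs_mult simp flip: left_diff_distrib intro!: mult_right_mono)
      qed
    qed
    have "\<exists>g. \<forall>y\<in>{x<..<B}. (\<lambda>n. Q n y) \<longlonglongrightarrow> g y \<and> (g has_derivative (*) (p y)) (at y within {x<..<B})"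
    proof (rule has_derivative_sequence[where f' = "\<lambda>n y. (*) (integral {y..B} (source (Q n)))"])
      show "(Q n has_derivative (*) (integral {y..B} (source (Q n)))) (at y within {x<..<B})"
        if "y \<in> {x<..<B}" for n y
        using der(1)[of y n] that x
        by (auto simp: has_field_derivative_def intro: has_derivative_at_withinI)
      show "(\<lambda>n. Q n s) \<longlonglongrightarrow> q s" using q_ptw s by auto
    qed (use ev x in auto)
    then obtain g where g: "\<And>y. y \<in> {x<..<B} \<Longrightarrow> (\<lambda>n. Q n y) \<longlonglongrightarrow> g y"
      "(g has_derivative (*) (p s)) (at s within {x<..<B})"
      using x by fastforce
    have "(g has_real_derivative p s) (at s)"
      using g(2) x by (simp add: has_field_derivative_def at_within_open[of s "{x<..<B}"])
    then show ?thesis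
    proof (rule has_field_derivative_transform_within_open[where S = "{x<..<B}"])
      show "g y = q y" if "y \<in> {x<..<B}" for y
        using LIMSEQ_unique[OF g(1)[OF that] q_ptw] that x by auto
    qed (use x in auto)
  qed
  have "Q n A = \<delta> n" for n by (rule reg_fixpoint_derivs(4)[OF d Q Q_fix])
  then have "(\<lambda>n. Q n A) \<longlonglongrightarrow> 0" using d_lim by simp
  moreover have "(\<lambda>n. Q n A) \<longlonglongrightarrow> q A" using q_ptw AB by simp
  ultimately have "q A = 0" using LIMSEQ_unique by blast
  moreover have "(q \<longlongrightarrow> q A) (at A within {A..B})"
    using q_cont AB by (simp add: continuous_on_def)
  then have "(q \<longlongrightarrow> q A) (at_right A)" using AB by (simp add: at_within_Icc_at_right)
  moreover have "(p \<longlongrightarrow> 0) (at_left B)"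
    using tail_integral_tendsto[OF src_cont, of "(A + B) / 2"] AB unfolding p_def by simp
  ultimately have "hodograph A B \<psi> q p"
    unfolding hodograph_def using q_pos q_der p_der by simp
  then show ?thesis by (rule that)
qed

end

subsection \<open>Inverting the derivative of the profile\<close>

lemma isCont_the_inv_into:
  fixes f :: "real \<Rightarrow> real"
  assumes "open S" "continuous_on S f" "inj_on f S" "y \<in> f ` S"
  shows "isCont (the_inv_into S f) y"
proof -
  obtain x where x: "x \<in> S" "y = f x" using assms(4) by blast
  obtain d where d: "d > 0" "cball x d \<subseteq> S"
    using \<open>open S\<close> x(1) open_contains_cball by blast
  have S: "z \<in> S" if "\<bar>z - x\<bar> \<le> d" for z
    using d(2) that by (auto simp: subset_iff dist_real_def abs_minus_commute)
  show ?thesis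
    unfolding x(2)
  proof (rule isCont_inverse_function[where f = f and x = x, OF d(1)])
    show "the_inv_into S f (f z) = z" if "\<bar>z - x\<bar> \<le> d" for z
      by (rule the_inv_into_f_f[OF assms(3) S[OF that]])
    show "isCont f z" if "\<bar>z - x\<bar> \<le> d" for z
      using assms(1,2) S[OF that] continuous_on_eq_continuous_at by blast
  qed
qed

lemma DERIV_the_inv_into:
  fixes f :: "real \<Rightarrow> real"
  assumes S: "open S" "continuous_on S f" "inj_on f S" "y \<in> f ` S"
    and D: "(f has_real_derivative D) (at (the_inv_into S f y))" "D \<noteq> 0"
  shows "(the_inv_into S f has_real_derivative inverse D) (at y)"
proof -
  have "open (f ` S)" by (rule invariance_of_domain[OF S(2,1,3)])
  then obtain e where e: "e > 0" "ball y e \<subseteq> f ` S" using S(4) open_contains_ball by blast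
  show ?thesis
  proof (rule DERIV_inverse_function[where f = f and g = "the_inv_into S f" and x = y
        and a = "y - e" and b = "y + e", OF D])
    show "f (the_inv_into S f z) = z" if "y - e < z" "z < y + e" for z
      using f_the_inv_into_f[OF S(3)] e(2) that by (auto simp: subset_iff dist_real_def abs_less_iff)
  qed (use e isCont_the_inv_into[OF S] in auto)
qed

text \<open>The exceptional point is 0 for \<open>p\<close>, where \<psi> may vanish, and the front
  \<open>b\<close> for a given solution and its flux, where no derivative is assumed.\<close>

lemma DERIV_neg_off_point_imp_decreasing:
  fixes f :: "real \<Rightarrow> real"
  assumes "x < y" "continuous_on {x..y} f"
    and neg: "\<And>s. x < s \<Longrightarrow> s < y \<Longrightarrow> s \<noteq> c \<Longrightarrow> \<exists>d. (f has_real_derivative d) (at s) \<and> d < 0"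
  shows "f y < f x"
proof (cases "x < c \<and> c < y")
  case True
  have "f c < f x"
    using True assms
    by (intro DERIV_neg_imp_decreasing_open[of x c f] continuous_on_subset[OF assms(2)]) auto
  moreover have "f y < f c"
    using True assms
    by (intro DERIV_neg_imp_decreasing_open[of c y f] continuous_on_subset[OF assms(2)]) auto
  ultimately show ?thesis by simp
next
  case False
  then show ?thesis
    using assms by (intro DERIV_neg_imp_decreasing_open[of x y f]) auto
qed

section \<open>Monotonicity and range of the derivative of a profile\<close>

locale hodograph_profile =
  fixes A B :: real and \<psi> q p :: "real \<Rightarrow> real"
  assumes A: "A < 0" and B: "0 < B"
    and psi_pos: "\<And>s. s \<in> {A..B} \<Longrightarrow> s \<noteq> 0 \<Longrightarrow> \<psi> s > 0"
    and psi_cont: "continuous_on {A..B} \<psi>"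
    and hodograph: "hodograph A B \<psi> q p"
begin

lemmas q_pos = hodographD(1)[OF hodograph]
  and q_deriv = hodographD(2)[OF hodograph]
  and p_deriv = hodographD(3)[OF hodograph]
  and q_tendsto = hodographD(4)[OF hodograph]
  and p_tendsto = hodographD(5)[OF hodograph]

lemma p_cont: "continuous_on {A<..<B} p" and q_cont: "continuous_on {A<..<B} q"
  by (rule DERIV_continuous_on, rule has_field_derivative_at_within, erule p_deriv q_deriv)+

lemma p_less:
  assumes "A < x" "x < y" "y < B"
  shows "p y < p x"
proof (rule DERIV_neg_off_point_imp_decreasing[where c = 0, OF assms(2)])
  show "continuous_on {x..y} p" using assms by (intro continuous_on_subset[OF p_cont]) auto
  fix s assume "x < s" "s < y" "s \<noteq> 0"
  then have s: "s \<in> {A<..<B}" "s \<noteq> 0" using assms by auto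
  then have "- (\<psi> s / (2 * q s)) < 0" using q_pos[OF s(1)] psi_pos[of s] by simp
  then show "\<exists>d. (p has_real_derivative d) (at s) \<and> d < 0" using p_deriv[OF s(1)] by blast
qed

lemma p_less_iff: "x \<in> {A<..<B} \<Longrightarrow> y \<in> {A<..<B} \<Longrightarrow> p x < p y \<longleftrightarrow> y < x"
  using p_less[of x y] p_less[of y x] by (cases x y rule: linorder_cases) auto

text \<open>\<open>p\<close> decreases to its limit 0 at \<open>B\<close>. The limit yields only
  \<open>0 \<le> p t\<close>; the strict decrease from \<open>s\<close> to \<open>t\<close> does the
  rest.\<close>

lemma p_pos:
  assumes s: "s \<in> {A<..<B}"
  shows "p s > 0"
proof -
  define t where "t = (s + B) / 2"
  have t: "s < t" "t < B" using s by (auto simp: t_def)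
  have "eventually (\<lambda>u. p u \<le> p t) (at_left B)"
    unfolding eventually_at_left_field using t s p_less less_imp_le
    by (intro exI[of _ t]) (auto intro: less_imp_le p_less)
  then have "0 \<le> p t" by (rule tendsto_upperbound[OF p_tendsto]) simp
  then show ?thesis using p_less[of s t] s t by auto
qed

text \<open>Otherwise \<open>q\<close> is at most linear near \<open>A\<close>, and \<open>p' = - \<psi> / (2 q)\<close> makes \<open>p\<close> diverge
  at least logarithmically.\<close>

lemma p_unbounded: "\<exists>s\<in>{A<..<B}. p s > K"
proof (rule ccontr)
  assume "\<not> ?thesis"
  then have p_le: "p s \<le> K" if "s \<in> {A<..<B}" for s using that by (auto simp: not_less)
  have "0 \<in> {A<..<B}" using A B by simp
  from p_le[OF this] p_pos[OF this] have K: "K > 0" by linarith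
  have q_le: "q s \<le> K * (s - A)" if s: "s \<in> {A<..<B}" for s
  proof -
    have "q s - q t \<le> K * (s - A)" if t: "A < t" "t < s" for t
    proof -
      obtain z where z: "t < z" "z < s" "q s - q t = (s - t) * p z"
        using MVT2[of t s q p] t s q_deriv by fastforce
      have "(s - t) * p z \<le> (s - A) * K"
        using p_le[of z] p_pos[of z] z t s by (intro mult_mono) auto
      then show ?thesis using z(3) by (simp add: mult.commute)
    qed
    then have "eventually (\<lambda>t. q s - q t \<le> K * (s - A)) (at_right A)"
      unfolding eventually_at_right_field using s by (intro exI[of _ s]) auto
    from tendsto_upperbound[OF tendsto_diff[OF tendsto_const q_tendsto] this] show ?thesis by simp
  qed
  \<comment> \<open>Stopping at \<open>A/2\<close> keeps clear of the possible zero of \<psi> at 0,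
    so that \<open>\<psi> m > 0\<close>.\<close>
  obtain m where m: "m \<in> {A..A/2}" "\<And>s. s \<in> {A..A/2} \<Longrightarrow> \<psi> m \<le> \<psi> s"
  proof -
    have "continuous_on {A..A/2} \<psi>" by (rule continuous_on_subset[OF psi_cont]) (use A B in auto)
    then show ?thesis using continuous_attains_inf[of "{A..A/2}" \<psi>] A that by auto
  qed
  \<comment> \<open>With \<open>q s \<le> K * (s - A)\<close> this gives
    \<open>\<psi> s / (2 * q s) \<ge> k / (s - A)\<close>, whose primitive is
    \<open>k * ln (s - A)\<close>.\<close>
  define k where "k = \<psi> m / (2 * K)"
  have k: "k > 0" using psi_pos[of m] m(1) A B K by (simp add: k_def)
  have "p (A/2) + k * ln (A/2 - A) - k * ln (s - A) \<le> p s" if s: "A < s" "s < A/2" for s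
  proof -
    have "p (A/2) + k * ln (A/2 - A) \<le> p s + k * ln (s - A)"
    proof (rule DERIV_nonpos_imp_nonincreasing[where f = "\<lambda>s. p s + k * ln (s - A)"])
      fix x assume x: "s \<le> x" "x \<le> A/2"
      then have xx: "x \<in> {A<..<B}" using s A B by auto
      have "((\<lambda>s. p s + k * ln (s - A)) has_real_derivative - (\<psi> x / (2 * q x)) + k / (x - A)) (at x)"
        using p_deriv[OF xx] xx by (auto intro!: derivative_eq_intros)
      moreover have "k / (x - A) \<le> \<psi> x / (2 * q x)"
      proof -
        have "\<psi> m \<le> \<psi> x" using m(2)[of x] x s by simp
        moreover have "0 < \<psi> m" using psi_pos[of m] m(1) A B by simp
        ultimately have "\<psi> m / (2 * (K * (x - A))) \<le> \<psi> x / (2 * q x)"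
          using q_le[OF xx] q_pos[OF xx] by (intro frac_le) auto
        then show ?thesis by (simp add: k_def mult_ac)
      qed
      ultimately show "\<exists>y. ((\<lambda>s. p s + k * ln (s - A)) has_real_derivative y) (at x) \<and> y \<le> 0"
        by force
    qed (use s in auto)
    then show ?thesis by simp
  qed
  then have "p (A/2) + k * ln (A/2 - A) - k * ln (s - A) \<le> K" if "A < s" "s < A/2" for s
    using p_le[of s] that A B by force
  then have ln_ge: "(p (A/2) + k * ln (A/2 - A) - K) / k \<le> ln (s - A)" if "A < s" "s < A/2" for s
    using that k by (simp add: pos_divide_le_eq algebra_simps)
  define c where "c = (p (A/2) + k * ln (A/2 - A) - K) / k"
  \<comment> \<open>The first entry of the minimum forces \<open>ln (s - A) \<le> c - 1\<close>,
    against \<open>ln_ge\<close>; the second keeps \<open>s\<close> to the left of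
    \<open>A/2\<close>.\<close>
  define s where "s = A + min (exp (c - 1)) (- A / 4)"
  have s: "A < s" "s < A/2" using A by (auto simp: s_def min_def)
  have "ln (s - A) \<le> ln (exp (c - 1))"
    using A by (subst ln_le_cancel_iff) (auto simp: s_def)
  moreover have "c \<le> ln (s - A)" using ln_ge[OF s] unfolding c_def .
  ultimately show False by simp
qed

text \<open>Since \<open>2 * p\<close> is the position, this says that the profile covers the whole
  open half-line. Large values come from \<open>p_unbounded\<close>, small ones from the limit at
  \<open>B\<close>, the rest from the intermediate value theorem.\<close>

lemma p_image: "p ` {A<..<B} = {0<..}"
proof (intro equalityI subsetI)
  fix y :: real assume y: "y \<in> {0<..}"
  obtain s1 where s1: "s1 \<in> {A<..<B}" "p s1 > y" using p_unbounded by blast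
  have "eventually (\<lambda>t. p t < y) (at_left B)"
    using order_tendstoD(2)[OF p_tendsto, of y] y by simp
  then obtain b where b: "b < B" "\<And>t. b < t \<Longrightarrow> t < B \<Longrightarrow> p t < y"
    unfolding eventually_at_left_field by blast
  define s2 where "s2 = (max b s1 + B) / 2"
  have s2: "s1 < s2" "s2 < B" "b < s2" using b(1) s1(1) by (auto simp: s2_def)
  have "continuous_on {s1..s2} p"
    by (rule continuous_on_subset[OF p_cont]) (use s1(1) s2(2) in auto)
  then obtain s where s: "s1 \<le> s" "s \<le> s2" "p s = y"
    using IVT2'[of p s2 y s1] b(2)[OF s2(3,2)] s1(2) s2(1) by auto
  then have "s \<in> {A<..<B}" using s1(1) s2(2) by auto
  then show "y \<in> p ` {A<..<B}" using s(3) by blast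
next
  fix y assume "y \<in> p ` {A<..<B}"
  then show "y \<in> {0<..}" using p_pos by auto
qed

end

subsection \<open>From the profile to a solution\<close>

lemma C2_onI:
  assumes "open S" "\<And>x. x \<in> S \<Longrightarrow> (f has_real_derivative f1 x) (at x)"
    "\<And>x. x \<in> S \<Longrightarrow> (f1 has_real_derivative f2 x) (at x)" "continuous_on S f2"
  shows "C2_on f S"
proof -
  have f1: "deriv f x = f1 x" if "x \<in> S" for x using assms(2)[OF that] by (rule DERIV_imp_deriv)
  have f2: "(deriv f has_real_derivative f2 x) (at x)" if "x \<in> S" for x
    by (rule has_field_derivative_transform_within_open[OF assms(3)[OF that] assms(1) that])
      (simp add: f1)
  have "deriv (deriv f) x = f2 x" if "x \<in> S" for x using f2[OF that] by (rule DERIV_imp_deriv)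
  then show ?thesis
    using assms(2) f2 continuous_on_cong[of S S "deriv (deriv f)" f2] assms(4)
    unfolding C2_on_def real_differentiable_def by auto
qed

lemma C2_on_subset: "C2_on f S \<Longrightarrow> T \<subseteq> S \<Longrightarrow> C2_on f T"
  unfolding C2_on_def by (auto intro: continuous_on_subset)

lemma C2_on_deriv:
  assumes "C2_on f S" "x \<in> S"
  shows "(f has_real_derivative deriv f x) (at x)"
    and "(deriv f has_real_derivative deriv (deriv f) x) (at x)"
  using assms unfolding C2_on_def by (auto simp: DERIV_deriv_iff_real_differentiable)

section \<open>The mobility common to both phases\<close>

locale free_boundary =
  fixes \<phi> :: "real \<Rightarrow> real" and \<epsilon> U0 V0 :: real
  assumes phi_C2: "C2_on \<phi> UNIV"
    and phi'_mono: "strict_mono_on {0..} (deriv \<phi>)" and phi'_0: "deriv \<phi> 0 = 0"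
    and eps: "\<epsilon> > 0" and U0: "U0 > 0" and V0: "V0 > 0"
begin

text \<open>The \<psi> of the hodograph equation. With \<epsilon> inside the branch
  \<open>s < 0\<close>, both equations have one form, and the flux condition says that one function
  has equal one-sided limits at the front.\<close>

definition mobility :: "real \<Rightarrow> real" where
  "mobility s = (if 0 \<le> s then deriv \<phi> s else \<epsilon> * deriv \<phi> (- s))"

text \<open>The derivative of \<open>mobility\<close> off 0. At 0 the one-sided derivatives are
  \<phi>''(0) and -\<epsilon> \<phi>''(0), so 0 is excluded in the facts about it.\<close>

definition mobility' :: "real \<Rightarrow> real" where
  "mobility' s = (if 0 \<le> s then deriv (deriv \<phi>) s else - (\<epsilon> * deriv (deriv \<phi>) (- s)))"

lemma phi'_pos: "s > 0 \<Longrightarrow> deriv \<phi> s > 0"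
  using strict_mono_onD[OF phi'_mono, of 0 s] phi'_0 by simp

lemma phi'_deriv: "(deriv \<phi> has_real_derivative deriv (deriv \<phi>) s) (at s)"
  by (rule C2_on_deriv(2)[OF phi_C2]) simp

lemma phi'_cont: "continuous_on S (deriv \<phi>)"
  by (rule DERIV_continuous_on, rule has_field_derivative_at_within, rule phi'_deriv)

lemma phi''_cont: "continuous_on S (deriv (deriv \<phi>))"
  using phi_C2 unfolding C2_on_def by (auto intro: continuous_on_subset)

lemma mobility_pos: "s \<noteq> 0 \<Longrightarrow> mobility s > 0"
  using phi'_pos[of s] phi'_pos[of "- s"] eps by (auto simp: mobility_def)

lemma mobility_0: "mobility 0 = 0"
  by (simp add: mobility_def phi'_0)

lemma mobility_nonneg: "mobility s \<ge> 0"
  using mobility_pos[of s] mobility_0 by (cases "s = 0") auto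

lemma mobility_cont: "continuous_on S mobility"
proof -
  have "continuous_on ({0..} \<union> {..0}) (\<lambda>s. if 0 \<le> s then deriv \<phi> s else \<epsilon> * deriv \<phi> (- s))"
    by (rule continuous_on_cases)
      (auto intro!: continuous_intros phi'_cont continuous_on_compose2[OF phi'_cont[of UNIV]] simp: phi'_0)
  moreover have "{0..} \<union> {..0} = (UNIV :: real set)" by auto
  ultimately show ?thesis
    unfolding mobility_def[abs_def] using continuous_on_subset by (metis subset_UNIV)
qed

lemma mobility_deriv:
  assumes "s \<noteq> 0"
  shows "(mobility has_real_derivative mobility' s) (at s)"
proof (cases "s > 0")
  case True
  have "(mobility has_real_derivative deriv (deriv \<phi>) s) (at s)"
    by (rule has_field_derivative_transform_within_open[OF phi'_deriv, of "{0<..}"])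
      (use True in \<open>auto simp: mobility_def\<close>)
  then show ?thesis using True by (simp add: mobility'_def)
next
  case False
  then have s: "s < 0" using assms by simp
  have "((\<lambda>s. \<epsilon> * deriv \<phi> (- s)) has_real_derivative - (\<epsilon> * deriv (deriv \<phi>) (- s))) (at s)"
    by (rule DERIV_cmult[OF DERIV_chain'[OF DERIV_minus[OF DERIV_ident] phi'_deriv], THEN DERIV_cong]) simp
  then have "(mobility has_real_derivative - (\<epsilon> * deriv (deriv \<phi>) (- s))) (at s)"
    by (rule has_field_derivative_transform_within_open[of _ _ _ "{..<0}"])
      (use s in \<open>auto simp: mobility_def\<close>)
  then show ?thesis using s by (simp add: mobility'_def)
qed

lemma mobility'_cont: "continuous_on (- {0}) mobility'"
proof -
  have "continuous_on {0<..} mobility'"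
    by (rule continuous_on_eq[OF phi''_cont]) (auto simp: mobility'_def)
  moreover have "continuous_on {..<0} (\<lambda>s. - (\<epsilon> * deriv (deriv \<phi>) (- s)))"
    by (auto intro!: continuous_intros continuous_on_compose2[OF phi''_cont[of UNIV]])
  then have "continuous_on {..<0} mobility'"
    by (rule continuous_on_eq) (auto simp: mobility'_def)
  ultimately have "continuous_on ({0<..} \<union> {..<0}) mobility'"
    by (intro continuous_on_open_Un) auto
  moreover have "{0<..} \<union> {..<0} = - {0::real}" by auto
  ultimately show ?thesis by simp
qed

end

section \<open>The solution belonging to a profile\<close>

locale free_boundary_profile = free_boundary +
  fixes q p :: "real \<Rightarrow> real"
  assumes hodograph: "hodograph (- V0) U0 mobility q p"
begin

sublocale hodograph_profile "- V0" U0 mobility q p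
  by unfold_locales (auto simp: U0 V0 mobility_pos mobility_cont hodograph)

definition profile_range :: "real set" where "profile_range = {- V0<..<U0}"

definition inverse_profile :: "real \<Rightarrow> real" where
  "inverse_profile = the_inv_into profile_range (\<lambda>s. 2 * p s)"

text \<open>\<open>2 * p\<close> never takes the value 0, so the boundary value is put in by hand;
  \<open>solution_at_0\<close> shows that it is the limit.\<close>

definition solution :: "real \<Rightarrow> real" where
  "solution \<eta> = (if \<eta> \<le> 0 then U0 else inverse_profile \<eta>)"

lemma two_p_inj: "inj_on (\<lambda>s. 2 * p s) profile_range"
  using p_less unfolding profile_range_def
  by (intro linorder_inj_onI') (metis greaterThanLessThan_iff less_irrefl mult_cancel_left zero_neq_numeral)

lemma two_p_image: "(\<lambda>s. 2 * p s) ` profile_range = {0<..}"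
proof -
  have "(\<lambda>s. 2 * p s) ` profile_range = (*) 2 ` p ` profile_range" by (simp add: image_image)
  also have "\<dots> = {0<..}"
    unfolding profile_range_def p_image
    by (auto simp: image_iff intro!: bexI[of _ "x / 2" for x])
  finally show ?thesis .
qed

lemma two_p_cont: "continuous_on profile_range (\<lambda>s. 2 * p s)"
  unfolding profile_range_def by (intro continuous_intros p_cont)

lemma open_range: "open profile_range"
  by (simp add: profile_range_def)

lemma zero_in_range: "0 \<in> profile_range"
  using U0 V0 by (simp add: profile_range_def)

lemma inverse_profile_in: "\<eta> > 0 \<Longrightarrow> inverse_profile \<eta> \<in> profile_range"
  and two_p_inverse_profile: "\<eta> > 0 \<Longrightarrow> 2 * p (inverse_profile \<eta>) = \<eta>"
  using the_inv_into_into[OF two_p_inj _ subset_refl, of \<eta>] f_the_inv_into_f[OF two_p_inj, of \<eta>]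
  unfolding inverse_profile_def two_p_image by auto

text \<open>As \<open>2 * p\<close> is strictly decreasing, comparing the inverse with a level
  \<open>s\<close> is comparing positions in reverse. The sign of the solution and its limits at 0
  and at infinity are read off from this.\<close>

lemma inverse_profile_less_iff:
  assumes "s \<in> profile_range" "\<eta> > 0"
  shows "inverse_profile \<eta> < s \<longleftrightarrow> 2 * p s < \<eta>" and "s < inverse_profile \<eta> \<longleftrightarrow> \<eta> < 2 * p s"
proof -
  have "2 * p s < 2 * p (inverse_profile \<eta>) \<longleftrightarrow> inverse_profile \<eta> < s"
    "2 * p (inverse_profile \<eta>) < 2 * p s \<longleftrightarrow> s < inverse_profile \<eta>"
    using p_less_iff inverse_profile_in[OF assms(2)] assms(1) by (auto simp: profile_range_def)
  then show "inverse_profile \<eta> < s \<longleftrightarrow> 2 * p s < \<eta>" and "s < inverse_profile \<eta> \<longleftrightarrow> \<eta> < 2 * p s"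
    by (auto simp: two_p_inverse_profile[OF assms(2)])
qed

definition front :: real where "front = 2 * p 0"

lemma front_pos: "front > 0"
  using p_pos[of 0] U0 V0 by (simp add: front_def)

lemma solution_sign:
  assumes "\<eta> \<ge> 0"
  shows "\<eta> < front \<longleftrightarrow> solution \<eta> > 0" "front < \<eta> \<longleftrightarrow> solution \<eta> < 0"
  using inverse_profile_less_iff[OF zero_in_range, of \<eta>] assms front_pos U0
  by (auto simp: solution_def front_def)

lemma isCont_inverse_profile: "\<eta> > 0 \<Longrightarrow> isCont inverse_profile \<eta>"
  unfolding inverse_profile_def
  by (rule isCont_the_inv_into[OF open_range two_p_cont two_p_inj]) (simp add: two_p_image)

lemma isCont_solution:
  assumes "\<eta> > 0"
  shows "isCont solution \<eta>"
proof -
  have "eventually (\<lambda>x. x \<in> {0<..}) (nhds \<eta>)"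
    using assms by (intro eventually_nhds_in_open) auto
  then have "eventually (\<lambda>x. solution x = inverse_profile x) (nhds \<eta>)"
    by eventually_elim (simp add: solution_def)
  then show ?thesis using isCont_inverse_profile[OF assms] isCont_cong by blast
qed

lemma solution_at_0: "(solution \<longlongrightarrow> U0) (at_right 0)"
proof (rule order_tendstoI)
  fix l assume "l < U0"
  define s where "s = (max l 0 + U0) / 2"
  have s: "s \<in> profile_range" "l < s" using U0 V0 \<open>l < U0\<close> by (auto simp: s_def profile_range_def)
  have "2 * p s > 0" using p_pos s(1) by (simp add: profile_range_def)
  moreover have "l < solution \<eta>" if "0 < \<eta>" "\<eta> < 2 * p s" for \<eta>
    using inverse_profile_less_iff(2)[OF s(1) that(1)] that s(2) by (simp add: solution_def)
  ultimately show "eventually (\<lambda>\<eta>. l < solution \<eta>) (at_right 0)"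
    unfolding eventually_at_right_field by blast
next
  fix u assume "U0 < u"
  have "solution \<eta> < u" for \<eta>
    using inverse_profile_in[of \<eta>] \<open>U0 < u\<close> by (auto simp: solution_def profile_range_def)
  then show "eventually (\<lambda>\<eta>. solution \<eta> < u) (at_right 0)" by simp
qed

lemma solution_cont: "continuous_on {0..} solution"
  unfolding continuous_on_def
proof
  fix \<eta> :: real assume "\<eta> \<in> {0..}"
  show "(solution \<longlongrightarrow> solution \<eta>) (at \<eta> within {0..})"
  proof (cases "\<eta> = 0")
    case True
    then show ?thesis using solution_at_0 by (simp add: at_within_Ici_at_right solution_def)
  next
    case False
    then have "isCont solution \<eta>" using isCont_solution \<open>\<eta> \<in> {0..}\<close> by simp
    then show ?thesis unfolding isCont_def by (rule tendsto_within_subset) simp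
  qed
qed

lemma solution_at_top: "(solution \<longlongrightarrow> - V0) at_top"
proof (rule order_tendstoI)
  fix l assume "l < - V0"
  then have "l < solution \<eta>" for \<eta>
    using inverse_profile_in[of \<eta>] U0 V0 by (auto simp: solution_def profile_range_def)
  then show "eventually (\<lambda>\<eta>. l < solution \<eta>) at_top" by simp
next
  fix u assume "- V0 < u"
  define s where "s = (min u 0 + - V0) / 2"
  have s: "s \<in> profile_range" "s < u" using U0 V0 \<open>- V0 < u\<close> by (auto simp: s_def profile_range_def)
  have "2 * p s > 0" using p_pos s(1) by (simp add: profile_range_def)
  then have "solution \<eta> < u" if "\<eta> > 2 * p s" for \<eta>
    using inverse_profile_less_iff(1)[OF s(1), of \<eta>] that s(2) by (simp add: solution_def)
  then show "eventually (\<lambda>\<eta>. solution \<eta> < u) at_top"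
    by (rule eventually_mono[OF eventually_gt_at_top[of "2 * p s"]])
qed

text \<open>The derivative of the solution as a function of its value: the relation between the flux
  and \<open>- q\<close>, solved for the derivative.\<close>

definition slope :: "real \<Rightarrow> real" where "slope s = - (q s / mobility s)"

definition slope' :: "real \<Rightarrow> real" where
  "slope' s = - ((p s * mobility s - q s * mobility' s) / (mobility s * mobility s))"

text \<open>The inverse function rule for \<open>2 * p\<close>, whose derivative is minus
  \<open>mobility\<close> over \<open>q\<close>. It vanishes at \<open>s = 0\<close>, so the front
  has to be left out.\<close>

lemma solution_deriv:
  assumes "\<eta> > 0" "\<eta> \<noteq> front"
  shows "(solution has_real_derivative slope (solution \<eta>)) (at \<eta>)"
proof -
  have s: "inverse_profile \<eta> \<in> profile_range" by (rule inverse_profile_in[OF assms(1)])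
  have nz: "inverse_profile \<eta> \<noteq> 0"
    using two_p_inverse_profile[OF assms(1)] assms(2) by (auto simp: front_def)
  have "q (inverse_profile \<eta>) > 0" "mobility (inverse_profile \<eta>) > 0"
    using q_pos s mobility_pos nz by (auto simp: profile_range_def)
  moreover have "((\<lambda>s. 2 * p s) has_real_derivative
      2 * - (mobility (inverse_profile \<eta>) / (2 * q (inverse_profile \<eta>)))) (at (inverse_profile \<eta>))"
    using p_deriv s by (intro DERIV_cmult) (simp add: profile_range_def)
  ultimately have "(inverse_profile has_real_derivative
      inverse (2 * - (mobility (inverse_profile \<eta>) / (2 * q (inverse_profile \<eta>))))) (at \<eta>)"
    unfolding inverse_profile_def using assms(1)
    by (intro DERIV_the_inv_into open_range two_p_cont two_p_inj) (auto simp: two_p_image)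
  then have "(inverse_profile has_real_derivative slope (inverse_profile \<eta>)) (at \<eta>)"
    by (rule DERIV_cong) (simp add: slope_def field_simps)
  then have "(solution has_real_derivative slope (inverse_profile \<eta>)) (at \<eta>)"
    by (rule has_field_derivative_transform_within_open[of _ _ _ "{0<..}"])
      (use assms in \<open>auto simp: solution_def\<close>)
  then show ?thesis using assms(1) by (simp add: solution_def)
qed

lemma solution_in:
  assumes "\<eta> > 0" "\<eta> \<noteq> front"
  shows "solution \<eta> \<in> profile_range - {0}"
  using inverse_profile_in[OF assms(1)] solution_sign[of \<eta>] assms by (auto simp: solution_def)

lemma slope_deriv:
  assumes "s \<in> profile_range - {0}"
  shows "(slope has_real_derivative slope' s) (at s)"
  unfolding slope_def[abs_def] slope'_def using assms mobility_pos[of s]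
  by (intro DERIV_minus DERIV_divide q_deriv mobility_deriv) (auto simp: profile_range_def)

lemma slope'_cont: "continuous_on (profile_range - {0}) slope'"
  unfolding slope'_def[abs_def]
  by (intro continuous_intros continuous_on_subset[OF p_cont] continuous_on_subset[OF q_cont]
      mobility_cont continuous_on_subset[OF mobility'_cont])
    (use mobility_pos in \<open>force simp: profile_range_def\<close>)+

lemma slope_cont: "continuous_on (profile_range - {0}) slope"
  by (rule DERIV_continuous_on, rule has_field_derivative_at_within, erule slope_deriv)

lemma solution_C2: "C2_on solution ({0<..} - {front})"
proof (rule C2_onI)
  show "(solution has_real_derivative slope (solution \<eta>)) (at \<eta>)" if "\<eta> \<in> {0<..} - {front}" for \<eta>
    using solution_deriv that by auto
  show "((\<lambda>\<eta>. slope (solution \<eta>)) has_real_derivative slope' (solution \<eta>) * slope (solution \<eta>)) (at \<eta>)"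
    if "\<eta> \<in> {0<..} - {front}" for \<eta>
    using that by (intro DERIV_chain2[OF slope_deriv solution_deriv] solution_in) auto
  have c: "continuous_on ({0<..} - {front}) solution"
    by (rule continuous_on_subset[OF solution_cont]) auto
  show "continuous_on ({0<..} - {front}) (\<lambda>\<eta>. slope' (solution \<eta>) * slope (solution \<eta>))"
    using solution_in
    by (intro continuous_on_mult continuous_on_compose2[OF slope'_cont c]
        continuous_on_compose2[OF slope_cont c]) auto
qed auto

lemma flux_eq:
  assumes "\<eta> > 0" "\<eta> \<noteq> front"
  shows "mobility (solution \<eta>) * deriv solution \<eta> = - q (solution \<eta>)"
proof -
  have "mobility (solution \<eta>) > 0" using mobility_pos solution_in[OF assms] by auto
  then show ?thesis
    using DERIV_imp_deriv[OF solution_deriv[OF assms]] by (simp add: slope_def)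
qed

text \<open>The flux is \<open>- q\<close> along the solution, \<open>q\<close> has derivative
  \<open>p\<close>, and \<open>2 * p (solution \<eta>) = \<eta>\<close> produces the factor
  \<eta>/2.\<close>

lemma flux_deriv:
  assumes "\<eta> > 0" "\<eta> \<noteq> front"
  shows "((\<lambda>x. mobility (solution x) * deriv solution x) has_real_derivative
           - (1 / 2) * \<eta> * deriv solution \<eta>) (at \<eta>)"
proof (rule has_field_derivative_transform_within_open)
  have "2 * p (solution \<eta>) = \<eta>"
    using two_p_inverse_profile[OF assms(1)] assms(1) by (simp add: solution_def)
  then have "p (solution \<eta>) = \<eta> / 2" by simp
  moreover have d: "((\<lambda>x. - q (solution x)) has_real_derivative
      - (p (solution \<eta>) * slope (solution \<eta>))) (at \<eta>)"
    using solution_in[OF assms]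
    by (intro DERIV_minus DERIV_chain2[OF q_deriv solution_deriv] assms) (auto simp: profile_range_def)
  ultimately show "((\<lambda>x. - q (solution x)) has_real_derivative - (1 / 2) * \<eta> * deriv solution \<eta>) (at \<eta>)"
    using DERIV_imp_deriv[OF solution_deriv[OF assms]] by (intro DERIV_cong[OF d]) simp
  show "open ({0<..} - {front})" by auto
qed (use assms flux_eq in auto)

text \<open>Although the solution need not be differentiable at the front, its flux is
  \<open>- q (solution \<eta>)\<close> nearby, and this is continuous there. Both one-sided limits
  therefore agree automatically.\<close>

lemma flux_tendsto: "((\<lambda>\<eta>. mobility (solution \<eta>) * deriv solution \<eta>) \<longlongrightarrow> - q 0) (at front)"
proof -
  have "solution front = 0" using solution_sign[of front] front_pos by auto
  moreover have "isCont q 0" using q_deriv[of 0] U0 V0 DERIV_isCont by auto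
  ultimately have "isCont (\<lambda>\<eta>. - q (solution \<eta>)) front"
    by (intro continuous_intros isCont_o2[OF isCont_solution[OF front_pos]]) simp
  then have *: "((\<lambda>\<eta>. - q (solution \<eta>)) \<longlongrightarrow> - q 0) (at front)"
    using \<open>solution front = 0\<close> by (simp add: isCont_def)
  have "eventually (\<lambda>\<eta>. \<eta> \<in> {0<..}) (at front)"
    using front_pos by (intro eventually_at_in_open') auto
  then have "eventually (\<lambda>\<eta>. - q (solution \<eta>) = mobility (solution \<eta>) * deriv solution \<eta>) (at front)"
    unfolding eventually_at_filter by eventually_elim (simp add: flux_eq)
  with * show ?thesis by (rule Lim_transform_eventually)
qed

lemma solution_fb_solution: "fb_solution \<phi> \<epsilon> U0 V0 solution front"
proof -
  have left: "mobility (solution \<eta>) = deriv \<phi> (solution \<eta>)" if "\<eta> \<in> {0<..<front}" for \<eta>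
    using solution_sign(1)[of \<eta>] that by (simp add: mobility_def)
  have right: "mobility (solution \<eta>) = \<epsilon> * deriv \<phi> (- solution \<eta>)" if "\<eta> \<in> {front<..}" for \<eta>
    using solution_sign(2)[of \<eta>] front_pos that by (simp add: mobility_def)
  have ev_left: "eventually (\<lambda>\<eta>. \<eta> \<in> {0<..<front}) (at_left front)"
    unfolding eventually_at_left_field using front_pos by (intro exI[of _ 0]) auto
  have ev_right: "eventually (\<lambda>\<eta>. \<eta> \<in> {front<..}) (at_right front)"
    unfolding eventually_at_right_field by (intro exI[of _ "front + 1"]) auto
  have C2: "C2_on solution {0<..<front}" "C2_on solution {front<..}"
    using front_pos by (auto intro!: C2_on_subset[OF solution_C2])
  have ode_left: "((\<lambda>x. deriv \<phi> (solution x) * deriv solution x) has_real_derivative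
      - (1 / 2) * \<eta> * deriv solution \<eta>) (at \<eta>)" if "\<eta> \<in> {0<..<front}" for \<eta>
    by (rule has_field_derivative_transform_within_open[OF flux_deriv, of _ "{0<..<front}"])
      (use that left in auto)
  have ode_right: "((\<lambda>x. \<epsilon> * deriv \<phi> (- solution x) * deriv solution x) has_real_derivative
      - (1 / 2) * \<eta> * deriv solution \<eta>) (at \<eta>)" if "\<eta> \<in> {front<..}" for \<eta>
    by (rule has_field_derivative_transform_within_open[OF flux_deriv, of _ "{front<..}"])
      (use that right front_pos in auto)
  have "((\<lambda>\<eta>. deriv \<phi> (solution \<eta>) * deriv solution \<eta>) \<longlongrightarrow> - q 0) (at_left front)"
    by (rule Lim_transform_eventually[OF tendsto_within_subset[OF flux_tendsto subset_UNIV]])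
      (use ev_left in eventually_elim, simp add: left)
  moreover have "((\<lambda>\<eta>. \<epsilon> * (deriv \<phi> (- solution \<eta>) * deriv solution \<eta>)) \<longlongrightarrow> - q 0) (at_right front)"
    by (rule Lim_transform_eventually[OF tendsto_within_subset[OF flux_tendsto subset_UNIV]])
      (use ev_right in eventually_elim, simp add: right)
  \<comment> \<open>The right-hand limit in \<open>fb_solution\<close> is taken without the factor
    \<epsilon>, which is divided out here.\<close>
  then have "((\<lambda>\<eta>. inverse \<epsilon> * (\<epsilon> * (deriv \<phi> (- solution \<eta>) * deriv solution \<eta>))) \<longlongrightarrow>
      inverse \<epsilon> * - q 0) (at_right front)"
    by (rule tendsto_mult_left)
  then have "((\<lambda>\<eta>. deriv \<phi> (- solution \<eta>) * deriv solution \<eta>) \<longlongrightarrow> - (q 0 / \<epsilon>)) (at_right front)"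
    using eps by (simp add: field_simps)
  moreover have "- q 0 = \<epsilon> * - (q 0 / \<epsilon>)" using eps by simp
  ultimately have flux: "\<exists>l r. ((\<lambda>\<eta>. deriv \<phi> (solution \<eta>) * deriv solution \<eta>) \<longlongrightarrow> l) (at_left front) \<and>
      ((\<lambda>\<eta>. deriv \<phi> (- solution \<eta>) * deriv solution \<eta>) \<longlongrightarrow> r) (at_right front) \<and> l = \<epsilon> * r"
    by blast
  have "solution front = 0" using solution_sign[of front] front_pos by auto
  then have at: "(solution \<longlongrightarrow> 0) (at front)"
    using isCont_solution[OF front_pos] by (simp add: isCont_def)
  then have "(solution \<longlongrightarrow> 0) (at_left front)" "((\<lambda>\<eta>. - solution \<eta>) \<longlongrightarrow> 0) (at_right front)"
    using tendsto_within_subset[OF at subset_UNIV] tendsto_minus[OF tendsto_within_subset[OF at subset_UNIV]]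
    by auto
  moreover have "solution 0 = U0" by (simp add: solution_def)
  moreover have "\<forall>\<eta>\<in>{front<..}. solution \<eta> < 0"
  proof
    fix \<eta> assume "\<eta> \<in> {front<..}"
    then show "solution \<eta> < 0" using solution_sign(2)[of \<eta>] front_pos by simp
  qed
  ultimately show ?thesis
    unfolding fb_solution_def
    using front_pos solution_cont solution_sign C2 ode_left ode_right solution_at_top flux by auto
qed

end

subsection \<open>From a solution to the profile\<close>

text \<open>A Gronwall argument: if |c| \<le> C between \<open>x\<close> and \<open>z\<close>, the
  weight \<open>exp (k * s)\<close> with \<open>k = 2 * C\<close> or \<open>k = - 2 * C\<close>
  makes the weighted square of \<open>y\<close> monotone towards \<open>z\<close>, so at
  \<open>x\<close> it cannot exceed its value 0 at \<open>z\<close>.\<close>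

lemma linear_ode_zero:
  fixes y c :: "real \<Rightarrow> real"
  assumes S: "\<And>u v. u \<in> S \<Longrightarrow> v \<in> S \<Longrightarrow> {u..v} \<subseteq> S"
    and y: "\<And>x. x \<in> S \<Longrightarrow> (y has_real_derivative - (c x * y x)) (at x)"
    and c: "continuous_on S c" and z: "z \<in> S" "y z = 0" and x: "x \<in> S"
  shows "y x = 0"
proof -
  define I where "I = {min x z..max x z}"
  have I: "I \<subseteq> S" unfolding I_def using S[OF x z(1)] S[OF z(1) x] by (auto simp: min_def max_def)
  have "compact (c ` I)"
    unfolding I_def[symmetric]
    by (rule compact_continuous_image[OF continuous_on_subset[OF c I]]) (simp add: I_def)
  then obtain C where "\<forall>u\<in>c ` I. \<bar>u\<bar> \<le> C"
    using compact_imp_bounded bounded_iff real_norm_def by metis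
  then have C: "\<bar>c s\<bar> \<le> C" if "s \<in> I" for s using that by blast
  have D: "((\<lambda>s. (y s)\<^sup>2 * exp (k * s)) has_real_derivative
      (y s)\<^sup>2 * exp (k * s) * (k - 2 * c s)) (at s)" if "s \<in> I" for s k
    using y[of s] that I
    by (auto intro!: derivative_eq_intros simp: algebra_simps power2_eq_square)
  have "(y x)\<^sup>2 * exp (k * x) \<le> (y z)\<^sup>2 * exp (k * z)"
    if k: "k = (if x \<le> z then 2 * C else - 2 * C)" for k
  proof (cases "x \<le> z")
    case True
    show ?thesis
    proof (rule DERIV_nonneg_imp_nondecreasing[OF True, where f = "\<lambda>s. (y s)\<^sup>2 * exp (k * s)"])
      fix s assume "x \<le> s" "s \<le> z"
      then have s: "s \<in> I" by (auto simp: I_def)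
      have "0 \<le> (y s)\<^sup>2 * exp (k * s) * (k - 2 * c s)"
        using C[OF s] True k by (intro mult_nonneg_nonneg) auto
      then show "\<exists>d. ((\<lambda>s. (y s)\<^sup>2 * exp (k * s)) has_real_derivative d) (at s) \<and> 0 \<le> d"
        using D[OF s] by blast
    qed
  next
    case False
    then have "z \<le> x" by simp
    show ?thesis
    proof (rule DERIV_nonpos_imp_nonincreasing[OF \<open>z \<le> x\<close>, where f = "\<lambda>s. (y s)\<^sup>2 * exp (k * s)"])
      fix s assume "z \<le> s" "s \<le> x"
      then have s: "s \<in> I" by (auto simp: I_def)
      have "(y s)\<^sup>2 * exp (k * s) * (k - 2 * c s) \<le> 0"
        using C[OF s] False k by (intro mult_nonneg_nonpos) auto
      then show "\<exists>d. ((\<lambda>s. (y s)\<^sup>2 * exp (k * s)) has_real_derivative d) (at s) \<and> d \<le> 0"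
        using D[OF s] by blast
    qed
  qed
  from this[OF refl] show ?thesis using z(2) by (simp add: mult_le_0_iff)
qed

lemma nonzero_negative:
  fixes F :: "real \<Rightarrow> real"
  assumes S: "connected S" and F: "continuous_on S F" "\<And>x. x \<in> S \<Longrightarrow> F x \<noteq> 0"
    and z: "z \<in> S" "F z < 0" and x: "x \<in> S"
  shows "F x < 0"
proof (rule ccontr)
  assume "\<not> F x < 0"
  moreover have "connected (F ` S)" by (rule connected_continuous_image[OF F(1) S])
  ultimately have "0 \<in> F ` S"
    using z x connectedD_interval[of "F ` S" "F z" "F x" 0] by simp
  then show False using F(2) by auto
qed

text \<open>On an interval with endpoint \<open>c\<close> the mean value theorem uses derivatives
  only strictly inside, so difference quotients at \<open>c\<close> are values of \<open>f'\<close>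
  at points tending to \<open>c\<close>. It carries the hodograph equations of a given solution
  across \<open>s = 0\<close>.\<close>

lemma DERIV_at_exceptional_point:
  fixes f f' :: "real \<Rightarrow> real"
  assumes S: "open S" "c \<in> S" and f: "continuous_on S f"
    and der: "\<And>x. x \<in> S - {c} \<Longrightarrow> (f has_real_derivative f' x) (at x)"
    and f': "isCont f' c"
  shows "(f has_real_derivative f' c) (at c)"
  unfolding has_field_derivative_iff
proof (rule tendstoI)
  fix e :: real assume "e > 0"
  then have "eventually (\<lambda>x. dist (f' x) (f' c) < e) (at c)"
    using f' tendstoD unfolding isCont_def by blast
  then obtain d1 where d1: "d1 > 0" "\<And>x. x \<noteq> c \<Longrightarrow> dist x c < d1 \<Longrightarrow> dist (f' x) (f' c) < e"
    unfolding eventually_at by blast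
  obtain d2 where d2: "d2 > 0" "ball c d2 \<subseteq> S" using S open_contains_ball by blast
  have *: "dist ((f y - f x) / (y - x)) (f' c) < e"
    if xy: "x < y" "x = c \<or> y = c" "y - x < min d1 d2" for x y
  proof -
    have sub: "{x..y} \<subseteq> S" using xy d2(2) by (auto simp: subset_iff dist_real_def)
    obtain z where z: "x < z" "z < y" "f y - f x = (*) (f' z) (y - x)"
    proof (rule mvt[OF xy(1)])
      show "continuous_on {x..y} f" by (rule continuous_on_subset[OF f sub])
      show "(f has_derivative (*) (f' z)) (at z)" if "x < z" "z < y" for z
      proof -
        have "z \<in> S" using sub that by auto
        then show ?thesis using der[of z] that xy by (simp add: has_field_derivative_def) force
      qed
    qed blast
    then have "(f y - f x) / (y - x) = f' z" using xy by simp
    moreover have "dist (f' z) (f' c) < e"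
      using z xy by (intro d1(2)) (auto simp: dist_real_def)
    ultimately show ?thesis by simp
  qed
  have "dist ((f y - f c) / (y - c)) (f' c) < e" if "y \<noteq> c" "dist y c < min d1 d2" for y
  proof (cases "y < c")
    case True
    have "(f y - f c) / (y - c) = (f c - f y) / (c - y)"
      using True by (simp add: field_simps)
    then show ?thesis using *[of y c] True that by (simp add: dist_real_def)
  next
    case False
    then show ?thesis using *[of c y] that by (simp add: dist_real_def)
  qed
  then show "eventually (\<lambda>y. dist ((f y - f c) / (y - c)) (f' c) < e) (at c)"
    unfolding eventually_at using d1(1) d2(1) by (intro exI[of _ "min d1 d2"]) auto
qed

section \<open>Sign and monotonicity of the flux of an arbitrary solution\<close>

locale given_fb_solution = free_boundary +
  fixes g :: "real \<Rightarrow> real" and b :: real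
  assumes sol: "fb_solution \<phi> \<epsilon> U0 V0 g b"
begin

lemma b_pos: "b > 0" and g_cont: "continuous_on {0..} g"
  and g_pos: "\<And>\<eta>. \<eta> \<in> {0..<b} \<Longrightarrow> g \<eta> > 0" and g_neg: "\<And>\<eta>. \<eta> \<in> {b<..} \<Longrightarrow> g \<eta> < 0"
  and g_C2_left: "C2_on g {0<..<b}" and g_C2_right: "C2_on g {b<..}"
  and g_0: "g 0 = U0" and g_at_top: "(g \<longlongrightarrow> - V0) at_top"
  and g_at_left: "(g \<longlongrightarrow> 0) (at_left b)"
  using sol unfolding fb_solution_def by auto

lemma isCont_g: "\<eta> > 0 \<Longrightarrow> isCont g \<eta>"
  using continuous_on_interior[OF g_cont] by simp

lemma g_b: "g b = 0"
proof -
  have "(g \<longlongrightarrow> g b) (at_left b)"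
    using isCont_g[OF b_pos] unfolding isCont_def by (rule tendsto_within_subset) simp
  then show ?thesis using g_at_left tendsto_unique trivial_limit_at_left_real by blast
qed

lemma g_deriv:
  assumes "\<eta> > 0" "\<eta> \<noteq> b"
  shows "(g has_real_derivative deriv g \<eta>) (at \<eta>)" and "isCont (deriv g) \<eta>"
  using C2_on_deriv[OF g_C2_left, of \<eta>] C2_on_deriv[OF g_C2_right, of \<eta>] assms
  by (cases "\<eta> < b"; auto intro: DERIV_isCont)+

lemma g_nonzero: "\<eta> > 0 \<Longrightarrow> \<eta> \<noteq> b \<Longrightarrow> g \<eta> \<noteq> 0"
  using g_pos[of \<eta>] g_neg[of \<eta>] by (cases "\<eta> < b") auto

lemma mobility_g_pos: "\<eta> > 0 \<Longrightarrow> \<eta> \<noteq> b \<Longrightarrow> mobility (g \<eta>) > 0"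
  by (intro mobility_pos g_nonzero)

lemma mobility_g_left: "\<eta> \<in> {0<..<b} \<Longrightarrow> mobility (g \<eta>) = deriv \<phi> (g \<eta>)"
  using g_pos[of \<eta>] by (simp add: mobility_def)

lemma mobility_g_right: "\<eta> \<in> {b<..} \<Longrightarrow> mobility (g \<eta>) = \<epsilon> * deriv \<phi> (- g \<eta>)"
  using g_neg[of \<eta>] by (simp add: mobility_def)

text \<open>Nothing is assumed about the derivative of \<open>g\<close> at \<open>b\<close>, so the
  value there is the limit, which makes the flux continuous across the front.\<close>

definition flux :: "real \<Rightarrow> real" where
  "flux \<eta> = (if \<eta> = b then Lim (at b) (\<lambda>x. mobility (g x) * deriv g x) else mobility (g \<eta>) * deriv g \<eta>)"

lemma flux_deriv:
  assumes "\<eta> > 0" "\<eta> \<noteq> b"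
  shows "(flux has_real_derivative - (1 / 2) * \<eta> * deriv g \<eta>) (at \<eta>)"
proof (cases "\<eta> < b")
  case True
  have "((\<lambda>x. deriv \<phi> (g x) * deriv g x) has_real_derivative - (1 / 2) * \<eta> * deriv g \<eta>) (at \<eta>)"
    using sol True assms unfolding fb_solution_def by simp
  then show ?thesis
    by (rule has_field_derivative_transform_within_open[of _ _ _ "{0<..<b}"])
      (use assms True mobility_g_left in \<open>auto simp: flux_def\<close>)
next
  case False
  then have "((\<lambda>x. \<epsilon> * deriv \<phi> (- g x) * deriv g x) has_real_derivative - (1 / 2) * \<eta> * deriv g \<eta>) (at \<eta>)"
    using sol assms unfolding fb_solution_def by simp
  then show ?thesis
    by (rule has_field_derivative_transform_within_open[of _ _ _ "{b<..}"])
      (use assms False mobility_g_right in \<open>auto simp: flux_def\<close>)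
qed

text \<open>The left limit is \<open>\<epsilon> * r\<close> by the flux condition; on the right
  \<open>mobility\<close> supplies the factor \<epsilon> in front of the limit
  \<open>r\<close>.\<close>

lemma isCont_flux_b: "isCont flux b"
proof -
  obtain r where r: "((\<lambda>\<eta>. deriv \<phi> (g \<eta>) * deriv g \<eta>) \<longlongrightarrow> \<epsilon> * r) (at_left b)"
    "((\<lambda>\<eta>. deriv \<phi> (- g \<eta>) * deriv g \<eta>) \<longlongrightarrow> r) (at_right b)"
    using sol unfolding fb_solution_def by blast
  have "eventually (\<lambda>\<eta>. \<eta> \<in> {0<..<b}) (at_left b)"
    unfolding eventually_at_left_field using b_pos by (intro exI[of _ 0]) auto
  then have "((\<lambda>\<eta>. mobility (g \<eta>) * deriv g \<eta>) \<longlongrightarrow> \<epsilon> * r) (at_left b)"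
    by (intro Lim_transform_eventually[OF r(1)])
      (erule eventually_mono, simp add: mobility_g_left)
  moreover have "eventually (\<lambda>\<eta>. \<eta> \<in> {b<..}) (at_right b)"
    unfolding eventually_at_right_field by (intro exI[of _ "b + 1"]) auto
  then have "((\<lambda>\<eta>. mobility (g \<eta>) * deriv g \<eta>) \<longlongrightarrow> \<epsilon> * r) (at_right b)"
    by (intro Lim_transform_eventually[OF tendsto_mult_left[OF r(2)]])
      (erule eventually_mono, simp add: mobility_g_right)
  ultimately have lim: "((\<lambda>\<eta>. mobility (g \<eta>) * deriv g \<eta>) \<longlongrightarrow> \<epsilon> * r) (at b)"
    by (rule filterlim_split_at)
  then have "flux b = \<epsilon> * r" by (simp add: flux_def tendsto_Lim)
  moreover have "(flux \<longlongrightarrow> \<epsilon> * r) (at b)"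
    by (rule Lim_transform_eventually[OF lim]) (simp add: flux_def eventually_at_filter)
  ultimately show ?thesis by (simp add: isCont_def)
qed

lemma isCont_flux: "\<eta> > 0 \<Longrightarrow> isCont flux \<eta>"
  using isCont_flux_b flux_deriv DERIV_isCont by (cases "\<eta> = b") blast+

lemma flux_cont: "(\<And>x. x \<in> S \<Longrightarrow> x > 0) \<Longrightarrow> continuous_on S flux"
  by (intro continuous_at_imp_continuous_on) (auto intro: isCont_flux)

lemma deriv_g_eq: "\<eta> > 0 \<Longrightarrow> \<eta> \<noteq> b \<Longrightarrow> deriv g \<eta> = flux \<eta> / mobility (g \<eta>)"
  using mobility_g_pos[of \<eta>] by (simp add: flux_def)

text \<open>On each side of the front, writing the derivative of \<open>g\<close> as flux over
  mobility turns the equation into a linear homogeneous one for the flux.\<close>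

lemma flux_zero_spreads:
  assumes S: "S = {0<..<b} \<or> S = {b<..}" and z: "z \<in> S" "flux z = 0" and x: "x \<in> S"
  shows "flux x = 0"
proof (rule linear_ode_zero[where c = "\<lambda>s. s / (2 * mobility (g s))" and y = flux, OF _ _ _ z x])
  have S': "s > 0" "s \<noteq> b" if "s \<in> S" for s using S that b_pos by auto
  show "(flux has_real_derivative - (s / (2 * mobility (g s)) * flux s)) (at s)" if "s \<in> S" for s
    by (rule DERIV_cong[OF flux_deriv[OF S'[OF that]]]) (simp add: deriv_g_eq[OF S'[OF that]])
  have "continuous_on S g" by (rule continuous_on_subset[OF g_cont]) (use S' in force)
  then show "continuous_on S (\<lambda>s. s / (2 * mobility (g s)))"
    using mobility_g_pos[OF S']
    by (intro continuous_intros continuous_on_compose2[OF mobility_cont[of UNIV]]) force+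
  show "{u..v} \<subseteq> S" if "u \<in> S" "v \<in> S" for u v using S that by auto
qed

text \<open>A zero of the flux would make \<open>g\<close> constant on its whole side of the front,
  while \<open>g\<close> falls from \<open>U0\<close> to 0 on the left and from 0 to negative values
  on the right.\<close>

lemma flux_nonzero:
  assumes "\<eta> > 0" "\<eta> \<noteq> b"
  shows "flux \<eta> \<noteq> 0"
proof
  assume 0: "flux \<eta> = 0"
  have const: "g y = g x"
    if xy: "0 \<le> x" "x < y" and flux: "\<And>s. x < s \<Longrightarrow> s < y \<Longrightarrow> s \<noteq> b \<and> flux s = 0" for x y
  proof (rule DERIV_isconst_end[OF xy(2)])
    show "continuous_on {x..y} g" by (rule continuous_on_subset[OF g_cont]) (use xy in auto)
    show "(g has_real_derivative 0) (at s)" if "x < s" "s < y" for s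
      using g_deriv(1)[of s] deriv_g_eq[of s] flux[OF that] xy that by simp
  qed
  show False
  proof (cases "\<eta> < b")
    case True
    then have "flux s = 0" if "s \<in> {0<..<b}" for s
      using flux_zero_spreads[of "{0<..<b}" \<eta> s] 0 assms that by auto
    then have "g b = g 0" by (intro const) (use b_pos in auto)
    then show False using g_b g_0 U0 by simp
  next
    case False
    then have "flux s = 0" if "s \<in> {b<..}" for s
      using flux_zero_spreads[of "{b<..}" \<eta> s] 0 assms that by auto
    then have "g (b + 1) = g b" by (intro const) (use b_pos in auto)
    then show False using g_b g_neg[of "b + 1"] by simp
  qed
qed

text \<open>A flux without zeros keeps one sign on each side; the drop of \<open>g\<close> across
  that side and the mean value theorem supply a point where it is negative.\<close>

lemma flux_neg_off_b:
  assumes "\<eta> > 0" "\<eta> \<noteq> b"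
  shows "flux \<eta> < 0"
proof -
  have ex: "\<exists>z. x < z \<and> z < y \<and> flux z < 0"
    if xy: "0 \<le> x" "x < y" "g y < g x" "b \<notin> {x<..<y}" for x y
  proof -
    obtain z where z: "x < z" "z < y" "g y - g x = (*) (deriv g z) (y - x)"
    proof (rule mvt[OF xy(2)])
      show "continuous_on {x..y} g" by (rule continuous_on_subset[OF g_cont]) (use xy in auto)
      show "(g has_derivative (*) (deriv g z)) (at z)" if "x < z" "z < y" for z
      proof -
        have "z > 0" "z \<noteq> b" using that xy by auto
        then show ?thesis using g_deriv(1) by (simp add: has_field_derivative_def)
      qed
    qed blast
    then have "deriv g z * (y - x) < 0" using xy by simp
    then have "deriv g z < 0" using xy(2) by (simp add: mult_less_0_iff)
    moreover have zb: "z > 0" "z \<noteq> b" using z xy by auto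
    moreover have "mobility (g z) > 0" by (rule mobility_g_pos[OF zb])
    ultimately have "flux z < 0" by (simp add: flux_def mult_pos_neg)
    then show ?thesis using z by blast
  qed
  show ?thesis
  proof (cases "\<eta> < b")
    case True
    obtain z where "0 < z" "z < b" "flux z < 0" using ex[of 0 b] g_b g_0 U0 b_pos by auto
    then show ?thesis
      using True assms flux_nonzero flux_cont[of "{0<..<b}"]
      by (intro nonzero_negative[of "{0<..<b}" flux z \<eta>]) auto
  next
    case False
    obtain z where "b < z" "flux z < 0" using ex[of b "b + 1"] g_b g_neg[of "b + 1"] b_pos by auto
    then show ?thesis
      using False assms flux_nonzero flux_cont[of "{b<..}"] b_pos
      by (intro nonzero_negative[of "{b<..}" flux z \<eta>]) auto
  qed
qed

lemma deriv_g_neg: "\<eta> > 0 \<Longrightarrow> \<eta> \<noteq> b \<Longrightarrow> deriv g \<eta> < 0"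
  using flux_neg_off_b mobility_g_pos deriv_g_eq by (simp add: divide_neg_pos)

lemma g_less:
  assumes xy: "0 \<le> x" "x < y"
  shows "g y < g x"
proof (rule DERIV_neg_off_point_imp_decreasing[where c = b, OF xy(2)])
  show "continuous_on {x..y} g" by (rule continuous_on_subset[OF g_cont]) (use xy in auto)
  show "\<exists>d. (g has_real_derivative d) (at s) \<and> d < 0" if "x < s" "s < y" "s \<noteq> b" for s
    using g_deriv(1)[of s] deriv_g_neg[of s] that xy by (intro exI[of _ "deriv g s"]) auto
qed

lemma g_less_iff: "0 < x \<Longrightarrow> 0 < y \<Longrightarrow> g x < g y \<longleftrightarrow> y < x"
  using g_less[of x y] g_less[of y x] by (cases x y rule: linorder_cases) auto

lemma flux_less:
  assumes "0 < x" "x < y"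
  shows "flux x < flux y"
proof -
  have "- flux y < - flux x"
  proof (rule DERIV_neg_off_point_imp_decreasing[where c = b and f = "\<lambda>x. - flux x", OF assms(2)])
    show "continuous_on {x..y} (\<lambda>x. - flux x)"
      by (intro continuous_intros flux_cont) (use assms in auto)
    show "\<exists>d. ((\<lambda>x. - flux x) has_real_derivative d) (at s) \<and> d < 0"
      if s: "x < s" "s < y" "s \<noteq> b" for s
    proof (intro exI conjI)
      show "((\<lambda>x. - flux x) has_real_derivative - (- (1 / 2) * s * deriv g s)) (at s)"
        by (intro DERIV_minus flux_deriv) (use s assms in auto)
      show "- (- (1 / 2) * s * deriv g s) < 0"
        using deriv_g_neg[of s] s assms by (simp add: mult_pos_neg)
    qed
  qed
  then show ?thesis by simp
qed

text \<open>At the front itself continuity would give only a nonstrict sign; strict monotonicity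
  gives \<open>flux b < flux (b + 1) < 0\<close>.\<close>

lemma flux_neg: "\<eta> > 0 \<Longrightarrow> flux \<eta> < 0"
  using flux_less[of b "b + 1"] flux_neg_off_b[of \<eta>] flux_neg_off_b[of "b + 1"] b_pos
  by (cases "\<eta> = b") auto

lemma g_bounds:
  assumes "\<eta> > 0"
  shows "g \<eta> \<in> {- V0<..<U0}"
proof -
  \<comment> \<open>The limit at infinity yields only \<open>- V0 \<le> g (\<eta> + 1)\<close>; the
    extra unit makes the bound at \<eta> strict.\<close>
  have "eventually (\<lambda>t. g t \<le> g (\<eta> + 1)) at_top"
    using eventually_gt_at_top[of "\<eta> + 1"]
    by eventually_elim (use g_less[of "\<eta> + 1"] assms in \<open>auto intro: less_imp_le\<close>)
  then have "- V0 \<le> g (\<eta> + 1)" by (rule tendsto_upperbound[OF g_at_top]) simp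
  then show ?thesis using g_less[of \<eta> "\<eta> + 1"] g_less[of 0 \<eta>] g_0 assms by auto
qed

lemma g_image: "g ` {0<..} = {- V0<..<U0}"
proof (intro equalityI subsetI)
  fix y assume y: "y \<in> {- V0<..<U0}"
  then have "eventually (\<lambda>t. g t < y \<and> t > 0) at_top"
    using order_tendstoD(2)[OF g_at_top, of y] eventually_gt_at_top[of 0]
    by (auto intro: eventually_conj)
  then obtain t where t: "g t < y" "t > 0" using eventually_happens by fastforce
  have "continuous_on {0..t} g" by (rule continuous_on_subset[OF g_cont]) auto
  then obtain x where x: "0 \<le> x" "x \<le> t" "g x = y"
    using IVT2'[of g t y 0] t y g_0 by auto
  then have "x \<noteq> 0" using y g_0 by auto
  then show "y \<in> g ` {0<..}" using x by force
next
  fix y assume "y \<in> g ` {0<..}"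
  then show "y \<in> {- V0<..<U0}" using g_bounds by blast
qed

section \<open>The inverse function of a given solution and its profile\<close>

lemma g_inj: "inj_on g {0<..}"
  using g_less by (intro linorder_inj_onI') (metis greaterThan_iff less_imp_le less_irrefl)

text \<open>Half of it will be the \<open>p\<close> component of the hodograph system attached to
  \<open>g\<close>.\<close>

definition pos_of :: "real \<Rightarrow> real" where "pos_of = the_inv_into {0<..} g"

lemma pos_of_g: "\<eta> > 0 \<Longrightarrow> pos_of (g \<eta>) = \<eta>"
  unfolding pos_of_def by (rule the_inv_into_f_f[OF g_inj]) simp

lemma pos_of_pos: "s \<in> {- V0<..<U0} \<Longrightarrow> pos_of s > 0"
  and g_pos_of: "s \<in> {- V0<..<U0} \<Longrightarrow> g (pos_of s) = s"
  using pos_of_g unfolding g_image[symmetric] by auto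

lemma g_cont_pos: "continuous_on {0<..} g"
  by (rule continuous_on_subset[OF g_cont]) auto

lemma isCont_pos_of: "s \<in> {- V0<..<U0} \<Longrightarrow> isCont pos_of s"
  unfolding pos_of_def
  by (rule isCont_the_inv_into[OF _ g_cont_pos g_inj]) (auto simp: g_image)

lemma pos_of_0: "pos_of 0 = b"
  using pos_of_g[OF b_pos] g_b by simp

lemma pos_of_less:
  assumes "s \<in> {- V0<..<U0}" "\<eta> > 0"
  shows "s < g \<eta> \<Longrightarrow> \<eta> < pos_of s" "g \<eta> < s \<Longrightarrow> pos_of s < \<eta>"
  using g_less_iff[OF assms(2) pos_of_pos[OF assms(1)]] g_less_iff[OF pos_of_pos[OF assms(1)] assms(2)]
  by (auto simp: g_pos_of[OF assms(1)])

lemma pos_of_deriv: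
  assumes s: "s \<in> {- V0<..<U0}" "s \<noteq> 0"
  shows "(pos_of has_real_derivative mobility s / flux (pos_of s)) (at s)"
    and "pos_of s \<noteq> b"
proof -
  show b: "pos_of s \<noteq> b" using g_pos_of[OF s(1)] g_b s(2) by auto
  note d = g_deriv(1)[OF pos_of_pos[OF s(1)] b]
  have "(pos_of has_real_derivative inverse (deriv g (pos_of s))) (at s)"
    using d deriv_g_neg[OF pos_of_pos[OF s(1)] b] s(1) unfolding pos_of_def
    by (intro DERIV_the_inv_into g_cont_pos g_inj) (auto simp: g_image)
  then show "(pos_of has_real_derivative mobility s / flux (pos_of s)) (at s)"
    by (rule DERIV_cong) (simp add: deriv_g_eq[OF pos_of_pos[OF s(1)] b] g_pos_of[OF s(1)])
qed

lemma isCont_flux_pos_of: "s \<in> {- V0<..<U0} \<Longrightarrow> isCont (\<lambda>s. flux (pos_of s)) s"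
  by (rule isCont_o2[OF isCont_pos_of isCont_flux[OF pos_of_pos]])

text \<open>With flux at most \<open>- e\<close>, and mobility at most \<open>K\<close> on
  \<open>[-V0, 0]\<close>, the solution would fall beyond the front at a rate of at least
  \<open>e / K\<close> and reach \<open>- V0\<close> at a finite position.\<close>

lemma flux_tends_to_0:
  assumes "e > 0"
  shows "\<exists>\<eta>>0. flux \<eta> > - e"
proof (rule ccontr)
  assume "\<not> ?thesis"
  then have le: "flux \<eta> \<le> - e" if "\<eta> > 0" for \<eta> using that by (meson not_less)
  obtain m where "m \<in> {- V0..0}" "\<And>s. s \<in> {- V0..0} \<Longrightarrow> mobility s \<le> mobility m"
    using continuous_attains_sup[of "{- V0..0}" mobility] mobility_cont V0 by auto
  then have m: "mobility s \<le> mobility m" if "s \<in> {- V0..0}" for s using that by blast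
  define K where "K = mobility m"
  have K: "K > 0" "\<And>s. s \<in> {- V0..0} \<Longrightarrow> mobility s \<le> K"
    using less_le_trans[OF mobility_pos[of "- V0"] m[of "- V0"]] m V0 by (simp_all add: K_def)
  \<comment> \<open>The distance in which a function falling at rate \<open>e / K\<close> from 0
    drops by \<open>V0\<close>.\<close>
  define t where "t = K * V0 / e"
  have t: "t > 0" using K V0 assms by (simp add: t_def)
  have "g (b + t) + e / K * (b + t) \<le> g b + e / K * b"
  proof (rule DERIV_nonpos_imp_decreasing_open[where f = "\<lambda>x. g x + e / K * x"])
    show "continuous_on {b..b + t} (\<lambda>x. g x + e / K * x)"
      by (intro continuous_intros continuous_on_subset[OF g_cont]) (use b_pos in auto)
    fix x assume x: "b < x" "x < b + t"
    then have x0: "x > 0" "x \<noteq> b" using b_pos by auto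
    have "mobility (g x) \<le> K" using K(2) g_bounds[OF x0(1)] g_neg[of x] x by simp
    then have "e / K \<le> e / mobility (g x)"
      using assms mobility_g_pos[OF x0] by (intro divide_left_mono) (auto simp: K)
    also have "\<dots> \<le> - flux x / mobility (g x)"
      using le[OF x0(1)] mobility_g_pos[OF x0] by (intro divide_right_mono) auto
    finally have "deriv g x + e / K \<le> 0" by (simp add: deriv_g_eq[OF x0])
    moreover have "((\<lambda>x. g x + e / K * x) has_real_derivative deriv g x + e / K) (at x)"
      using g_deriv(1)[OF x0] K(1) by (auto intro!: derivative_eq_intros)
    ultimately show "\<exists>d. ((\<lambda>x. g x + e / K * x) has_real_derivative d) (at x) \<and> d \<le> 0" by blast
  qed (use t in auto)
  then have "g (b + t) \<le> - (e / K * t)" by (simp add: g_b distrib_left)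
  also have "e / K * t = V0" using K assms by (simp add: t_def)
  finally show False using g_bounds[of "b + t"] b_pos t by simp
qed

text \<open>Off \<open>s = 0\<close> this is the chain rule, the mobility cancelling in the
  derivative of the flux. At 0 the equations follow from continuity of both sides, which is where
  the flux condition at the front enters. The limit at \<open>- V0\<close> is the decay of the
  flux.\<close>

lemma given_hodograph:
  "hodograph (- V0) U0 mobility (\<lambda>s. - flux (pos_of s)) (\<lambda>s. pos_of s / 2)"
  unfolding hodograph_def
proof (intro conjI ballI)
  let ?I = "{- V0<..<U0}"
  have I0: "0 \<in> ?I" using U0 V0 by simp
  have q: "((\<lambda>s. - flux (pos_of s)) has_real_derivative pos_of s / 2) (at s)"
    if s: "s \<in> ?I - {0}" for s
  proof -
    have s': "s \<in> ?I" "s \<noteq> 0" using s by auto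
    note b = pos_of_deriv(2)[OF s'] and pos = pos_of_pos[OF s'(1)]
    have "((\<lambda>s. - flux (pos_of s)) has_real_derivative
        - (- (1 / 2) * pos_of s * deriv g (pos_of s) * (mobility s / flux (pos_of s)))) (at s)"
      by (rule DERIV_minus[OF DERIV_chain2[OF flux_deriv[OF pos b] pos_of_deriv(1)[OF s']]])
    then show ?thesis
      by (rule DERIV_cong)
        (use flux_neg[OF pos] mobility_pos[OF s'(2)] in
          \<open>simp add: deriv_g_eq[OF pos b] g_pos_of[OF s'(1)]\<close>)
  qed
  have p: "((\<lambda>s. pos_of s / 2) has_real_derivative - (mobility s / (2 * - flux (pos_of s)))) (at s)"
    if s: "s \<in> ?I - {0}" for s
    by (rule DERIV_cong[OF DERIV_cdivide[OF pos_of_deriv(1)]]) (use s in auto)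
  fix s assume s: "s \<in> ?I"
  show "- flux (pos_of s) > 0" using flux_neg[OF pos_of_pos[OF s]] by simp
  show "((\<lambda>s. - flux (pos_of s)) has_real_derivative pos_of s / 2) (at s)"
  proof (cases "s = 0")
    case True
    have "((\<lambda>s. - flux (pos_of s)) has_real_derivative pos_of 0 / 2) (at 0)"
      using isCont_flux_pos_of isCont_pos_of[OF I0] I0
      by (intro DERIV_at_exceptional_point[of ?I 0] q)
        (auto intro!: continuous_at_imp_continuous_on continuous_intros)
    then show ?thesis using True by simp
  qed (use q s in auto)
  show "((\<lambda>s. pos_of s / 2) has_real_derivative - (mobility s / (2 * - flux (pos_of s)))) (at s)"
  proof (cases "s = 0")
    case True
    have "isCont mobility 0" using mobility_cont[of UNIV] continuous_on_eq_continuous_at by blast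
    then have "isCont (\<lambda>s. - (mobility s / (2 * - flux (pos_of s)))) 0"
      using isCont_flux_pos_of[OF I0] flux_neg[OF pos_of_pos[OF I0]]
      by (intro continuous_intros) auto
    then have "((\<lambda>s. pos_of s / 2) has_real_derivative - (mobility 0 / (2 * - flux (pos_of 0)))) (at 0)"
      using isCont_pos_of I0
      by (intro DERIV_at_exceptional_point[of ?I 0] p)
        (auto intro!: continuous_at_imp_continuous_on continuous_intros)
    then show ?thesis using True by simp
  qed (use p s in auto)
next
  show "((\<lambda>s. - flux (pos_of s)) \<longlongrightarrow> 0) (at_right (- V0))"
  proof (rule order_tendstoI)
    fix l :: real assume "l < 0"
    have "l < - flux (pos_of s)" if "- V0 < s" "s < U0" for s
      using flux_neg[OF pos_of_pos[of s]] that \<open>l < 0\<close> by simp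
    then show "eventually (\<lambda>s. l < - flux (pos_of s)) (at_right (- V0))"
      unfolding eventually_at_right_field using U0 V0 by (intro exI[of _ U0]) auto
  next
    fix u :: real assume "0 < u"
    then obtain \<eta> where \<eta>: "\<eta> > 0" "flux \<eta> > - u" using flux_tends_to_0 by blast
    have "- flux (pos_of s) < u" if "- V0 < s" "s < g \<eta>" for s
      using pos_of_less(1)[of s \<eta>] flux_less[of \<eta> "pos_of s"] \<eta> that g_bounds[OF \<eta>(1)] by simp
    then show "eventually (\<lambda>s. - flux (pos_of s) < u) (at_right (- V0))"
      unfolding eventually_at_right_field using g_bounds[OF \<eta>(1)] by (intro exI[of _ "g \<eta>"]) auto
  qed
  show "((\<lambda>s. pos_of s / 2) \<longlongrightarrow> 0) (at_left U0)"
  proof (rule order_tendstoI)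
    fix l :: real assume "l < 0"
    have "l < pos_of s / 2" if "- V0 < s" "s < U0" for s
      using pos_of_pos[of s] that \<open>l < 0\<close> by simp
    then show "eventually (\<lambda>s. l < pos_of s / 2) (at_left U0)"
      unfolding eventually_at_left_field using U0 V0 by (intro exI[of _ "- V0"]) auto
  next
    fix u :: real assume u: "0 < u"
    have "pos_of s / 2 < u" if "g (2 * u) < s" "s < U0" for s
      using pos_of_less(2)[of s "2 * u"] that g_bounds[of "2 * u"] u by simp
    then show "eventually (\<lambda>s. pos_of s / 2 < u) (at_left U0)"
      unfolding eventually_at_left_field using g_bounds[of "2 * u"] u by (intro exI[of _ "g (2 * u)"]) auto
  qed
qed

end

text \<open>Both solutions yield profiles of the same hodograph problem, so their inverse functions
  coincide on \<open>{- V0<..<U0}\<close>; at the level \<open>s = 0\<close> this identifies the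
  fronts.\<close>

lemma (in free_boundary) fb_solution_unique:
  assumes f: "fb_solution \<phi> \<epsilon> U0 V0 f a" and g: "fb_solution \<phi> \<epsilon> U0 V0 g b"
  shows "b = a \<and> (\<forall>\<eta>\<ge>0. g \<eta> = f \<eta>)"
proof -
  interpret f: given_fb_solution \<phi> \<epsilon> U0 V0 f a by unfold_locales (rule f)
  interpret g: given_fb_solution \<phi> \<epsilon> U0 V0 g b by unfold_locales (rule g)
  have pos_of: "f.pos_of s = g.pos_of s" if "s \<in> {- V0<..<U0}" for s
    using hodograph_unique[OF f.given_hodograph g.given_hodograph mobility_nonneg that] by simp
  have "g \<eta> = f \<eta>" if "\<eta> \<ge> 0" for \<eta>
  proof (cases "\<eta> = 0")
    case False
    then have "\<eta> > 0" using that by simp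
    then have "f (g.pos_of (g \<eta>)) = g \<eta>"
      using f.g_pos_of[OF g.g_bounds] pos_of[OF g.g_bounds] by simp
    then show ?thesis using g.pos_of_g \<open>\<eta> > 0\<close> by simp
  qed (simp add: f.g_0 g.g_0)
  moreover have "b = a" using f.pos_of_0 g.pos_of_0 pos_of[of 0] U0 V0 by simp
  ultimately show ?thesis by blast
qed

theorem theorem3p18:
  fixes \<phi> :: "real \<Rightarrow> real" and \<epsilon> U0 V0 :: real
  assumes "C2_on \<phi> UNIV"
    and "strict_mono_on {0..} \<phi>"
    and "strict_mono_on {0..} (deriv \<phi>)"
    and "\<And>s. s > 0 \<Longrightarrow> \<phi> s > 0"
    and "\<phi> 0 = 0"
    and "deriv \<phi> 0 = 0"
    and "(\<integral>\<^sup>+s\<in>{0<..<1}. ennreal (deriv \<phi> s / s) \<partial>lborel) < \<infinity>"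
    and "(\<integral>\<^sup>+s\<in>{1<..}. ennreal (deriv \<phi> s / s) \<partial>lborel) = \<infinity>"
    and "\<epsilon> > 0" and "U0 > 0" and "V0 > 0"
  shows "\<exists>f a. fb_solution \<phi> \<epsilon> U0 V0 f a \<and>
           (\<forall>g b. fb_solution \<phi> \<epsilon> U0 V0 g b \<longrightarrow> b = a \<and> (\<forall>\<eta>\<ge>0. g \<eta> = f \<eta>))"
proof -
  interpret free_boundary \<phi> \<epsilon> U0 V0
    using assms by unfold_locales auto
  interpret singular_bvp "- V0" U0 mobility
    using U0 V0 by unfold_locales (auto simp: mobility_cont mobility_nonneg)
  obtain q p where "hodograph (- V0) U0 mobility q p"
    by (rule hodograph_exists) (use mobility_pos[of U0] U0 in auto)
  then interpret free_boundary_profile \<phi> \<epsilon> U0 V0 q p by unfold_locales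
  show ?thesis
    using solution_fb_solution fb_solution_unique[OF solution_fb_solution] by blast
qed

end
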